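(* Let $\mathbf X\in\mathbb R^{n\times d}$ with $n\ge d$, let $\lambda\ge0$, $s\in\{0,\dots,n\}$ and $\delta\in(0,1)$, where in the case $\lambda=0$ it is assumed that $\mathbf X$ has rank $d$ and $s\ge d$. Then algorithm FastRegVol$(\mathbf X,s,\lambda)$ samples according to $\lambda$-regularized size $s$ volume sampling over $\mathbf X$, and with probability at least $1-\delta$ it runs in time $$O\Big(\big(n+\log(n/d)\log(1/\delta)\big)d^2\Big).$$
   Context: $\mathbf x_i^\top$ is the $i$-th row of $\mathbf X$; $\mathbf X_S$ is the submatrix of rows indexed by $S$. Time counts elementary real arithmetic operations and elementary random draws (a uniform draw from the current set or a Bernoulli draw costs $O(1)$; sampling an index from an explicit list of $m$ nonnegative weights costs $O(m)$). $\lambda$-regularized size $s$ volume sampling over $\mathbf X$ is the distribution of the set obtained as follows: start with $S=\{1,\dots,n\}$; while $|S|>s$, pick $i\in S$ with probability proportional to $\dfrac{\det(\mathbf X_{S\setminus\{i\}}^\top\mathbf X_{S\setminus\{i\}}+\lambda\mathbf I)}{\det(\mathbf X_S^\top\mathbf X_S+\lambda\mathbf I)}$ and replace $S$ by $S\setminus\{i\}$. Algorithm RegVol$(\mathbf X,s,\lambda)$, for $\mathbf X$ with $n$ rows: $\mathbf Z\leftarrow(\mathbf X^\top\mathbf X+\lambda\mathbf I)^{-1}$; for all $i\in\{1,\dots,n\}$, $h_i\leftarrow1-\mathbf x_i^\top\mathbf Z\mathbf x_i$; $S\leftarrow\{1,\dots,n\}$; while $|S|>s$: sample $i\in S$ with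 probability proportional to $h_i$; $S\leftarrow S\setminus\{i\}$; $\mathbf v\leftarrow\mathbf Z\mathbf x_i/\sqrt{h_i}$; for all $j\in S$, $h_j\leftarrow h_j-(\mathbf x_j^\top\mathbf v)^2$; $\mathbf Z\leftarrow\mathbf Z+\mathbf v\mathbf v^\top$; return $S$. Algorithm FastRegVol$(\mathbf X,s,\lambda)$: $\mathbf Z\leftarrow(\mathbf X^\top\mathbf X+\lambda\mathbf I)^{-1}$; $S\leftarrow\{1,\dots,n\}$; while $|S|>\max\{s,2d\}$: repeat { sample $i$ uniformly from $S$; $h_i\leftarrow1-\mathbf x_i^\top\mathbf Z\mathbf x_i$; sample $A\sim\mathrm{Bernoulli}(h_i)$ } until $A=1$; then $S\leftarrow S\setminus\{i\}$ and $\mathbf Z\leftarrow\mathbf Z+h_i^{-1}\mathbf Z\mathbf x_i\mathbf x_i^\top\mathbf Z$; end while. If $s<2d$, set $S\leftarrow$ RegVol$(\mathbf X_S,s,\lambda)$ (keeping the original row labels). Return $S$. *)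

theory Defs
  imports
    "HOL-Probability.Probability"
    "Jordan_Normal_Form.Determinant"
    "Jordan_Normal_Form.DL_Rank"
    "Jordan_Normal_Form.DL_Submatrix"
    "Jordan_Normal_Form.Gauss_Jordan_Elimination"
begin

section \<open>Regularized volume sampling\<close>

text \<open>
  Rows are indexed by \<^term>\<open>{..<n}\<close>.  Distributions are subprobability mass functions, so that
  possibly nonterminating programs have a denotation: the missing mass is the probability of
  divergence (or of a draw from weights that sum to zero).
\<close>

definition row_submatrix :: "real mat \<Rightarrow> nat set \<Rightarrow> real mat" where
  "row_submatrix X S = submatrix X S UNIV"

definition reg_gram :: "real mat \<Rightarrow> real \<Rightarrow> real mat" where
  "reg_gram X lam = transpose_mat X * X + lam \<cdot>\<^sub>m 1\<^sub>m (dim_col X)"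

definition weighted_spmf :: "nat set \<Rightarrow> (nat \<Rightarrow> real) \<Rightarrow> nat spmf" where
  "weighted_spmf S w = embed_spmf (\<lambda>i. if i \<in> S then w i / (\<Sum>j\<in>S. w j) else 0)"

partial_function (spmf) volume_sampling_from ::
  "real mat \<Rightarrow> nat \<Rightarrow> real \<Rightarrow> nat set \<Rightarrow> nat set spmf" where
  "volume_sampling_from X s lam S =
     (if card S > s then
        bind_spmf
          (weighted_spmf S (\<lambda>i. Determinant.det (reg_gram (row_submatrix X (S - {i})) lam)
                                / Determinant.det (reg_gram (row_submatrix X S) lam)))
          (\<lambda>i. volume_sampling_from X s lam (S - {i}))
      else return_spmf S)"

definition volume_sampling :: "real mat \<Rightarrow> nat \<Rightarrow> real \<Rightarrow> nat set spmf" where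
  "volume_sampling X s lam = volume_sampling_from X s lam {..<dim_row X}"


section \<open>Cost model\<close>

text \<open>
  A timed computation is its result together with the number of elementary operations it
  performed.  Real arithmetic operations and comparisons of a real with zero cost 1; control flow,
  index manipulation and data movement are free.
\<close>

type_synonym 'a timed = "'a \<times> nat"

definition ret :: "'a \<Rightarrow> 'a timed" where
  "ret x = (x, 0)"

definition bind_timed :: "'a timed \<Rightarrow> ('a \<Rightarrow> 'b timed) \<Rightarrow> 'b timed" where
  "bind_timed m f = (fst (f (fst m)), snd m + snd (f (fst m)))"

type_synonym 'a rtimed = "'a timed spmf"

definition lift :: "'a timed \<Rightarrow> 'a rtimed" where
  "lift m = return_spmf m"

definition bind_rtimed :: "'a rtimed \<Rightarrow> ('a \<Rightarrow> 'b rtimed) \<Rightarrow> 'b rtimed" where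
  "bind_rtimed p f = bind_spmf p (\<lambda>(x, t). map_spmf (\<lambda>(y, u). (y, t + u)) (f x))"

lemma bind_rtimed_mono [partial_function_mono]:
  assumes "mono_spmf B" "\<And>x. mono_spmf (\<lambda>f. C x f)"
  shows "mono_spmf (\<lambda>f. bind_rtimed (B f) (\<lambda>x. C x f))"
  unfolding bind_rtimed_def case_prod_beta
  by (intro bind_spmf_mono map_spmf_mono assms)

text \<open>
  Every \<^typ>\<open>'a rtimed\<close> is also an spmf and a pmf; do-notation below refers only to the two
  cost-accumulating binds.
\<close>

no_adhoc_overloading Monad_Syntax.bind \<rightleftharpoons> bind_pmf bind_spmf
adhoc_overloading Monad_Syntax.bind \<rightleftharpoons> bind_timed bind_rtimed

definition add_t :: "real \<Rightarrow> real \<Rightarrow> real timed" where "add_t x y = (x + y, 1)"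
definition sub_t :: "real \<Rightarrow> real \<Rightarrow> real timed" where "sub_t x y = (x - y, 1)"
definition mul_t :: "real \<Rightarrow> real \<Rightarrow> real timed" where "mul_t x y = (x * y, 1)"
definition div_t :: "real \<Rightarrow> real \<Rightarrow> real timed" where "div_t x y = (x / y, 1)"
definition sqrt_t :: "real \<Rightarrow> real timed" where "sqrt_t x = (sqrt x, 1)"

definition uniform_t :: "nat set \<Rightarrow> nat rtimed" where
  "uniform_t S = map_spmf (\<lambda>i. (i, 1)) (spmf_of_set S)"

text \<open>\<^const>\<open>bernoulli_pmf\<close> clamps its parameter to the unit interval.\<close>

definition bernoulli_t :: "real \<Rightarrow> bool rtimed" where
  "bernoulli_t p = map_spmf (\<lambda>b. (b, 1)) (spmf_of_pmf (bernoulli_pmf p))"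

definition weighted_t :: "nat set \<Rightarrow> (nat \<Rightarrow> real) \<Rightarrow> nat rtimed" where
  "weighted_t S w = map_spmf (\<lambda>i. (i, card S)) (weighted_spmf S w)"


section \<open>Timed linear algebra\<close>

text \<open>Entrywise loops: the cost is the total cost of computing the entries.\<close>

primrec sum_t :: "nat \<Rightarrow> (nat \<Rightarrow> real timed) \<Rightarrow> real timed" where
  "sum_t 0 f = ret 0"
| "sum_t (Suc n) f = do { a \<leftarrow> sum_t n f; b \<leftarrow> f n; add_t a b }"

definition vec_t :: "nat \<Rightarrow> (nat \<Rightarrow> real timed) \<Rightarrow> real vec timed" where
  "vec_t n f = (Matrix.vec n (\<lambda>i. fst (f i)), \<Sum>i<n. snd (f i))"

definition mat_t :: "nat \<Rightarrow> nat \<Rightarrow> (nat \<times> nat \<Rightarrow> real timed) \<Rightarrow> real mat timed" where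
  "mat_t nr nc f = (Matrix.mat nr nc (\<lambda>ij. fst (f ij)), \<Sum>i<nr. \<Sum>j<nc. snd (f (i, j)))"

definition table_t :: "nat set \<Rightarrow> (nat \<Rightarrow> real timed) \<Rightarrow> (nat \<Rightarrow> real) timed" where
  "table_t S f = ((\<lambda>j. if j \<in> S then fst (f j) else 0), \<Sum>j\<in>S. snd (f j))"

definition dot_t :: "real vec \<Rightarrow> real vec \<Rightarrow> real timed" where
  "dot_t u v = sum_t (dim_vec v) (\<lambda>k. mul_t (vec_index u k) (vec_index v k))"

definition mat_vec_t :: "real mat \<Rightarrow> real vec \<Rightarrow> real vec timed" where
  "mat_vec_t A v = vec_t (dim_row A) (\<lambda>i. dot_t (Matrix.row A i) v)"

definition mat_mul_t :: "real mat \<Rightarrow> real mat \<Rightarrow> real mat timed" where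
  "mat_mul_t A B = mat_t (dim_row A) (dim_col B) (\<lambda>(i, j). dot_t (Matrix.row A i) (Matrix.col B j))"

definition add_diag_t :: "real mat \<Rightarrow> real \<Rightarrow> real mat timed" where
  "add_diag_t A c = mat_t (dim_row A) (dim_col A)
     (\<lambda>(i, j). if i = j then add_t (A $$ (i, j)) c else ret (A $$ (i, j)))"

definition add_outer_t :: "real mat \<Rightarrow> real vec \<Rightarrow> real vec \<Rightarrow> real mat timed" where
  "add_outer_t A u w = mat_t (dim_row A) (dim_col A)
     (\<lambda>(i, j). do { q \<leftarrow> mul_t (vec_index u i) (vec_index w j); add_t (A $$ (i, j)) q })"

text \<open>
  Matrix inversion by Gauss--Jordan elimination on the pair of matrices \<^term>\<open>(A, 1\<^sub>m n)\<close>: step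
  \<^term>\<open>k\<close> swaps the first row at or below row \<^term>\<open>k\<close> with a nonzero entry in column \<^term>\<open>k\<close>
  into row \<^term>\<open>k\<close>, normalizes that row and clears the rest of the column.  The result is only
  meaningful for invertible matrices.
\<close>

definition pivot_t :: "nat \<Rightarrow> real mat \<Rightarrow> nat timed" where
  "pivot_t k A = (LEAST r. k \<le> r \<and> (r < dim_row A \<longrightarrow> A $$ (r, k) \<noteq> 0), dim_row A - k)"

definition scale_row_t :: "nat \<Rightarrow> real \<Rightarrow> real mat \<Rightarrow> real mat timed" where
  "scale_row_t k p A = mat_t (dim_row A) (dim_col A)
     (\<lambda>(i, j). if i = k then div_t (A $$ (i, j)) p else ret (A $$ (i, j)))"

definition clear_rows_t :: "nat \<Rightarrow> real vec \<Rightarrow> real mat \<Rightarrow> real mat timed" where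
  "clear_rows_t k c A = mat_t (dim_row A) (dim_col A)
     (\<lambda>(i, j). if i = k then ret (A $$ (i, j))
               else do { q \<leftarrow> mul_t (vec_index c i) (A $$ (k, j)); sub_t (A $$ (i, j)) q })"

definition gauss_jordan_step_t ::
  "nat \<Rightarrow> real mat \<times> real mat \<Rightarrow> (real mat \<times> real mat) timed" where
  "gauss_jordan_step_t k AB = do {
     r \<leftarrow> pivot_t k (fst AB);
     let A = swaprows k r (fst AB);
     let B = swaprows k r (snd AB);
     A' \<leftarrow> scale_row_t k (A $$ (k, k)) A;
     B' \<leftarrow> scale_row_t k (A $$ (k, k)) B;
     A'' \<leftarrow> clear_rows_t k (Matrix.col A' k) A';
     B'' \<leftarrow> clear_rows_t k (Matrix.col A' k) B';
     ret (A'', B'')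
   }"

primrec gauss_jordan_t ::
  "nat \<Rightarrow> real mat \<times> real mat \<Rightarrow> (real mat \<times> real mat) timed" where
  "gauss_jordan_t 0 AB = ret AB"
| "gauss_jordan_t (Suc k) AB = do { AB' \<leftarrow> gauss_jordan_t k AB; gauss_jordan_step_t k AB' }"

definition inverse_t :: "real mat \<Rightarrow> real mat timed" where
  "inverse_t A = do {
     LR \<leftarrow> gauss_jordan_t (dim_row A) (A, 1\<^sub>m (dim_row A));
     ret (snd LR)
   }"

definition reg_gram_inverse_t :: "real mat \<Rightarrow> real \<Rightarrow> real mat timed" where
  "reg_gram_inverse_t X lam = do {
     G \<leftarrow> mat_mul_t (transpose_mat X) X;
     R \<leftarrow> add_diag_t G lam;
     inverse_t R
   }"

text \<open>The value $1 - x^\top Z x$.\<close>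

definition one_minus_quad_t :: "real mat \<Rightarrow> real vec \<Rightarrow> real timed" where
  "one_minus_quad_t Z x = do { u \<leftarrow> mat_vec_t Z x; q \<leftarrow> dot_t x u; sub_t 1 q }"


section \<open>Algorithm RegVol\<close>

text \<open>
  RegVol is run on the submatrix of the rows in \<^term>\<open>S\<close>, with the rows keeping the labels they
  have in \<^term>\<open>X\<close>; RegVol on the whole of \<^term>\<open>X\<close> is the case
  \<^term>\<open>S = {..<dim_row X}\<close>.
\<close>

definition scaled_image_t :: "real mat \<Rightarrow> real vec \<Rightarrow> real \<Rightarrow> real vec timed" where
  "scaled_image_t Z x h = do {
     u \<leftarrow> mat_vec_t Z x;
     r \<leftarrow> sqrt_t h;
     vec_t (dim_vec u) (\<lambda>k. div_t (vec_index u k) r)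
   }"

definition downdate_t :: "real \<Rightarrow> real vec \<Rightarrow> real vec \<Rightarrow> real timed" where
  "downdate_t h x v = do { p \<leftarrow> dot_t x v; q \<leftarrow> mul_t p p; sub_t h q }"

partial_function (spmf) reg_vol_loop ::
  "real mat \<Rightarrow> nat \<Rightarrow> nat set \<Rightarrow> real mat \<Rightarrow> (nat \<Rightarrow> real) \<Rightarrow> nat set rtimed" where
  "reg_vol_loop X s S Z h =
     (if card S > s then do {
        i \<leftarrow> weighted_t S h;
        v \<leftarrow> lift (scaled_image_t Z (Matrix.row X i) (h i));
        h' \<leftarrow> lift (table_t (S - {i}) (\<lambda>j. downdate_t (h j) (Matrix.row X j) v));
        Z' \<leftarrow> lift (add_outer_t Z v v);
        reg_vol_loop X s (S - {i}) Z' h'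
      } else lift (ret S))"

definition reg_vol :: "real mat \<Rightarrow> nat set \<Rightarrow> nat \<Rightarrow> real \<Rightarrow> nat set rtimed" where
  "reg_vol X S s lam = do {
     Z \<leftarrow> lift (reg_gram_inverse_t (row_submatrix X S) lam);
     h \<leftarrow> lift (table_t S (\<lambda>i. one_minus_quad_t Z (Matrix.row X i)));
     reg_vol_loop X s S Z h
   }"


section \<open>Algorithm FastRegVol\<close>

partial_function (spmf) rejection_loop ::
  "real mat \<Rightarrow> nat set \<Rightarrow> real mat \<Rightarrow> (nat \<times> real) rtimed" where
  "rejection_loop X S Z = do {
     i \<leftarrow> uniform_t S;
     h \<leftarrow> lift (one_minus_quad_t Z (Matrix.row X i));
     A \<leftarrow> bernoulli_t h;
     if A then lift (ret (i, h)) else rejection_loop X S Z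
   }"

text \<open>The update $Z + h^{-1} Z x x^\top Z$, computed as $Z + (h^{-1} (Z x)) (Z^\top x)^\top$.\<close>

definition rank_one_update_t :: "real mat \<Rightarrow> real vec \<Rightarrow> real \<Rightarrow> real mat timed" where
  "rank_one_update_t Z x h = do {
     u \<leftarrow> mat_vec_t Z x;
     w \<leftarrow> mat_vec_t (transpose_mat Z) x;
     c \<leftarrow> div_t 1 h;
     u' \<leftarrow> vec_t (dim_vec u) (\<lambda>k. mul_t c (vec_index u k));
     add_outer_t Z u' w
   }"

partial_function (spmf) fast_reg_vol_loop ::
  "real mat \<Rightarrow> nat \<Rightarrow> nat set \<Rightarrow> real mat \<Rightarrow> nat set rtimed" where
  "fast_reg_vol_loop X m S Z =
     (if card S > m then do {
        ih \<leftarrow> rejection_loop X S Z;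
        Z' \<leftarrow> lift (rank_one_update_t Z (Matrix.row X (fst ih)) (snd ih));
        fast_reg_vol_loop X m (S - {fst ih}) Z'
      } else lift (ret S))"

definition fast_reg_vol :: "real mat \<Rightarrow> nat \<Rightarrow> real \<Rightarrow> nat set rtimed" where
  "fast_reg_vol X s lam = do {
     Z \<leftarrow> lift (reg_gram_inverse_t X lam);
     S \<leftarrow> fast_reg_vol_loop X (max s (2 * dim_col X)) {..<dim_row X} Z;
     if s < 2 * dim_col X then reg_vol X S s lam else lift (ret S)
   }"

definition output_distribution :: "'a rtimed \<Rightarrow> 'a spmf" where
  "output_distribution p = map_spmf fst p"

definition prob_time_le :: "'a rtimed \<Rightarrow> real \<Rightarrow> real" where
  "prob_time_le p b = measure (measure_spmf p) {(x, t). real t \<le> b}"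

end

(*
  The trial loop of FastRegVol returns i with probability proportional to h_i = 1 - x_i^T Z x_i, and
  by the matrix determinant lemma h_i = det(G - x_i x_i^T) / det(G) when Z is the inverse of the
  regularized Gram matrix G of the current rows; the Sherman-Morrison formula keeps Z the inverse.
  Since sum_i x_i^T Z x_i = d - lambda tr Z <= d, a trial among at least 2d rows succeeds with
  probability at least 1/2.  If theta makes one trial multiply exp(theta * time) by 4/3, the
  exponential moment of a whole trial loop is therefore at most 2, that of n rounds is at most 5^n,
  and Markov's inequality gives time O(d^2 (n + log(1/delta))).  The factor log(n/d) only matters
  when n > 2d, where it exceeds log 2; otherwise no trial is made and the time is deterministic.
*)
theory Submission
  imports Defs
begin

text \<open>Both loops carry one invariant, \<open>inv_gram S Z\<close>: the matrix in hand is
  exactly the inverse for the remaining rows. Rows of removal weight zero are drawn with probability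
  zero, so no update divides by zero and, for \<open>lam = 0\<close>, the remaining rows keep full
  rank. The obstacle is the trial loop, whose running time is unbounded and which is given only as a
  least fixed point that might lose mass. Fixed-point induction transports upper bounds on
  integrals, not lower ones: it yields the exponential moment but not termination. The output law
  comes instead from solving the fixed-point equation, which is linear in the unknown probabilities,
  and termination is inherited afterwards from volume sampling, where it follows by induction on the
  number of rows. The value 4/3 is chosen because with success probability 1/2 a moment bound M must
  satisfy 4/3 * (1/2 + M/2) <= M, whose least solution is 2.\<close>

unbundle no vec_syntax and no inner_syntax

section \<open>Values and costs of the timed operations\<close>

lemma fst_ret [simp]: "fst (ret x) = x" and snd_ret [simp]: "snd (ret x) = 0"
  by (simp_all add: ret_def)

lemma fst_bind_timed [simp]: "fst (bind_timed m f) = fst (f (fst m))"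
  and snd_bind_timed [simp]: "snd (bind_timed m f) = snd m + snd (f (fst m))"
  by (simp_all add: bind_timed_def)

lemma elementary_t [simp]:
  "fst (add_t x y) = x + y" "snd (add_t x y) = 1"
  "fst (sub_t x y) = x - y" "snd (sub_t x y) = 1"
  "fst (mul_t x y) = x * y" "snd (mul_t x y) = 1"
  "fst (div_t x y) = x / y" "snd (div_t x y) = 1"
  "fst (sqrt_t x) = sqrt x" "snd (sqrt_t x) = 1"
  by (simp_all add: add_t_def sub_t_def mul_t_def div_t_def sqrt_t_def)

lemma fst_sum_t [simp]: "fst (sum_t n f) = (\<Sum>i<n. fst (f i))"
  by (induction n) auto

lemma snd_sum_t [simp]: "snd (sum_t n f) = (\<Sum>i<n. snd (f i)) + n"
  by (induction n) auto

lemma vec_t_simps [simp]: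
  "fst (vec_t n f) = Matrix.vec n (\<lambda>i. fst (f i))" "snd (vec_t n f) = (\<Sum>i<n. snd (f i))"
  by (simp_all add: vec_t_def)

lemma mat_t_simps [simp]:
  "fst (mat_t nr nc f) = Matrix.mat nr nc (\<lambda>ij. fst (f ij))"
  "snd (mat_t nr nc f) = (\<Sum>i<nr. \<Sum>j<nc. snd (f (i, j)))"
  by (simp_all add: mat_t_def)

lemma table_t_simps [simp]:
  "fst (table_t S f) = (\<lambda>j. if j \<in> S then fst (f j) else 0)"
  "snd (table_t S f) = (\<Sum>j\<in>S. snd (f j))"
  by (simp_all add: table_t_def)

lemma fst_dot_t [simp]: "fst (dot_t u v) = u \<bullet> v"
  by (simp add: dot_t_def scalar_prod_def atLeast0LessThan)

lemma snd_dot_t [simp]: "snd (dot_t u v) = 2 * dim_vec v"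
  by (simp add: dot_t_def)

lemma fst_mat_vec_t [simp]: "fst (mat_vec_t A v) = A *\<^sub>v v"
  by (auto simp: mat_vec_t_def)

lemma snd_mat_vec_t [simp]: "snd (mat_vec_t A v) = dim_row A * (2 * dim_vec v)"
  by (simp add: mat_vec_t_def)

lemma times_mat_index_eq_sum:
  fixes A B :: "real mat"
  assumes "A \<in> carrier_mat n m" "B \<in> carrier_mat m p" "i < n" "j < p"
  shows "(A * B) $$ (i, j) = (\<Sum>l<m. A $$ (i, l) * B $$ (l, j))"
  using assms by (simp add: scalar_prod_def atLeast0LessThan)

lemma fst_mat_mul_t [simp]: "fst (mat_mul_t A B) = A * B"
  by (auto simp: mat_mul_t_def)

lemma snd_mat_mul_t [simp]: "snd (mat_mul_t A B) = dim_row A * (dim_col B * (2 * dim_row B))"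
  by (simp add: mat_mul_t_def)

lemma fst_add_diag_t: "A \<in> carrier_mat n n \<Longrightarrow> fst (add_diag_t A c) = A + c \<cdot>\<^sub>m 1\<^sub>m n"
  by (auto simp: add_diag_t_def)

lemma mat_t_cost_le:
  assumes "\<And>i j. snd (f (i, j)) \<le> c"
  shows "snd (mat_t nr nc f) \<le> nr * nc * c"
proof -
  have "(\<Sum>i<nr. \<Sum>j<nc. snd (f (i, j))) \<le> (\<Sum>i<nr. \<Sum>j<nc. c)"
    by (intro sum_mono assms)
  then show ?thesis
    by simp
qed

lemma snd_add_diag_t: "snd (add_diag_t A c) \<le> dim_row A * dim_col A"
  unfolding add_diag_t_def by (rule order_trans[OF mat_t_cost_le[where c = 1]]) auto

lemma fst_add_outer_t:
  "fst (add_outer_t A u w) = Matrix.mat (dim_row A) (dim_col A) (\<lambda>(i, j). A $$ (i, j) + u $ i * w $ j)"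
  by (auto simp: add_outer_t_def case_prod_beta)

lemma snd_add_outer_t [simp]: "snd (add_outer_t A u w) = dim_row A * (dim_col A * 2)"
  by (simp add: add_outer_t_def)

lemma fst_scale_row_t:
  "fst (scale_row_t k p A) = Matrix.mat (dim_row A) (dim_col A)
     (\<lambda>(i, j). if i = k then A $$ (i, j) / p else A $$ (i, j))"
  by (auto simp: scale_row_t_def case_prod_beta)

lemma snd_scale_row_t: "snd (scale_row_t k p A) \<le> dim_row A * dim_col A"
  unfolding scale_row_t_def by (rule order_trans[OF mat_t_cost_le[where c = 1]]) auto

lemma fst_clear_rows_t:
  "fst (clear_rows_t k c A) = Matrix.mat (dim_row A) (dim_col A)
     (\<lambda>(i, j). if i = k then A $$ (i, j) else A $$ (i, j) - c $ i * A $$ (k, j))"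
  by (auto simp: clear_rows_t_def case_prod_beta)

lemma snd_clear_rows_t: "snd (clear_rows_t k c A) \<le> dim_row A * dim_col A * 2"
  unfolding clear_rows_t_def by (rule mat_t_cost_le) auto

lemma fst_pivot_t: "fst (pivot_t k A) = (LEAST r. k \<le> r \<and> (r < dim_row A \<longrightarrow> A $$ (r, k) \<noteq> 0))"
  and snd_pivot_t: "snd (pivot_t k A) = dim_row A - k"
  by (simp_all add: pivot_t_def)

lemma fst_one_minus_quad_t [simp]: "fst (one_minus_quad_t Z x) = 1 - x \<bullet> (Z *\<^sub>v x)"
  by (simp add: one_minus_quad_t_def)

lemma snd_one_minus_quad_t [simp]:
  "snd (one_minus_quad_t Z x) = dim_row Z * (2 * dim_vec x) + 2 * dim_row Z + 1"
  by (simp add: one_minus_quad_t_def)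

lemma fst_scaled_image_t:
  "fst (scaled_image_t Z x h) = Matrix.vec (dim_row Z) (\<lambda>k. (Z *\<^sub>v x) $ k / sqrt h)"
  by (simp add: scaled_image_t_def)

lemma snd_scaled_image_t:
  "snd (scaled_image_t Z x h) = dim_row Z * (2 * dim_vec x) + 1 + dim_row Z"
  by (simp add: scaled_image_t_def)

lemma downdate_t_simps:
  "fst (downdate_t h x v) = h - (x \<bullet> v)\<^sup>2" "snd (downdate_t h x v) = 2 * dim_vec v + 2"
  by (simp_all add: downdate_t_def power2_eq_square)

lemma fst_rank_one_update_t:
  "fst (rank_one_update_t Z x h) = Matrix.mat (dim_row Z) (dim_col Z)
     (\<lambda>(i, j). Z $$ (i, j) + 1 / h * (Z *\<^sub>v x) $ i * (transpose_mat Z *\<^sub>v x) $ j)"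
  by (rule eq_matI) (auto simp: rank_one_update_t_def fst_add_outer_t)

lemma snd_rank_one_update_t:
  "snd (rank_one_update_t Z x h) =
     dim_row Z * (2 * dim_vec x) + dim_col Z * (2 * dim_vec x) + 1 + dim_row Z + dim_row Z * (dim_col Z * 2)"
  by (simp add: rank_one_update_t_def)

section \<open>Dimensions and costs in Gauss--Jordan elimination\<close>

lemma gauss_jordan_step_t_dim:
  assumes "fst AB \<in> carrier_mat d d" "snd AB \<in> carrier_mat d d"
  shows "fst (fst (gauss_jordan_step_t k AB)) \<in> carrier_mat d d"
    "snd (fst (gauss_jordan_step_t k AB)) \<in> carrier_mat d d"
  using assms by (simp_all add: gauss_jordan_step_t_def Let_def fst_scale_row_t fst_clear_rows_t carrier_matD)

text \<open>Per step: at most \<open>d\<close> for the pivot search, \<open>d * d\<close> for each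
  of two row scalings and \<open>2 * (d * d)\<close> for each of two clearings. Only dimensions
  enter, so the bound also covers singular input, where the pivot search may return an index past
  the last row.\<close>

lemma snd_gauss_jordan_step_t:
  assumes "fst AB \<in> carrier_mat d d" "snd AB \<in> carrier_mat d d"
  shows "snd (gauss_jordan_step_t k AB) \<le> d + 6 * (d * d)"
proof -
  have scale: "snd (scale_row_t k p M) \<le> d * d" and clear: "snd (clear_rows_t k c M) \<le> 2 * (d * d)"
    if "M \<in> carrier_mat d d" for p c M
    using snd_scale_row_t[of k p M] snd_clear_rows_t[of k c M] that by auto
  have dims: "fst (scale_row_t k p M) \<in> carrier_mat d d" "swaprows k l M \<in> carrier_mat d d"
    if "M \<in> carrier_mat d d" for p M l
    using that by (simp_all add: fst_scale_row_t carrier_matD)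
  let ?r = "fst (pivot_t k (fst AB))"
  let ?A = "swaprows k ?r (fst AB)" and ?B = "swaprows k ?r (snd AB)"
  let ?A' = "fst (scale_row_t k (?A $$ (k, k)) ?A)" and ?B' = "fst (scale_row_t k (?A $$ (k, k)) ?B)"
  have "snd (gauss_jordan_step_t k AB) =
      snd (pivot_t k (fst AB)) + (snd (scale_row_t k (?A $$ (k, k)) ?A)
        + (snd (scale_row_t k (?A $$ (k, k)) ?B)
        + (snd (clear_rows_t k (Matrix.col ?A' k) ?A') + snd (clear_rows_t k (Matrix.col ?A' k) ?B'))))"
    by (simp add: gauss_jordan_step_t_def Let_def)
  also have "\<dots> \<le> d + (d * d + (d * d + (2 * (d * d) + 2 * (d * d))))"
    by (intro add_mono scale clear dims assms) (use assms in \<open>auto simp: snd_pivot_t\<close>)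
  finally show ?thesis
    by simp
qed

lemma gauss_jordan_t_dim:
  assumes "fst AB \<in> carrier_mat d d" "snd AB \<in> carrier_mat d d"
  shows "fst (fst (gauss_jordan_t k AB)) \<in> carrier_mat d d \<and> snd (fst (gauss_jordan_t k AB)) \<in> carrier_mat d d"
  using assms gauss_jordan_step_t_dim by (induction k) auto

lemma snd_gauss_jordan_t:
  assumes "fst AB \<in> carrier_mat d d" "snd AB \<in> carrier_mat d d"
  shows "snd (gauss_jordan_t k AB) \<le> k * (d + 6 * (d * d))"
proof (induction k)
  case (Suc k)
  have "snd (gauss_jordan_step_t k (fst (gauss_jordan_t k AB))) \<le> d + 6 * (d * d)"
    using snd_gauss_jordan_step_t gauss_jordan_t_dim[OF assms, of k] by blast
  then show ?case
    using Suc by simp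
qed simp

lemma inverse_t_carrier: "A \<in> carrier_mat d d \<Longrightarrow> fst (inverse_t A) \<in> carrier_mat d d"
  using gauss_jordan_t_dim[of "(A, 1\<^sub>m d)" d d] by (simp add: inverse_t_def)

lemma snd_inverse_t: "A \<in> carrier_mat d d \<Longrightarrow> snd (inverse_t A) \<le> d * (d + 6 * (d * d))"
  using snd_gauss_jordan_t[of "(A, 1\<^sub>m d)" d d] by (simp add: inverse_t_def)

lemma fst_reg_gram_inverse_t:
  "fst (reg_gram_inverse_t X lam) = fst (inverse_t (reg_gram X lam))"
proof -
  have "transpose_mat X * X \<in> carrier_mat (dim_col X) (dim_col X)"
    by (rule carrier_matI) simp_all
  then show ?thesis
    by (simp add: reg_gram_inverse_t_def reg_gram_def fst_add_diag_t)
qed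

lemma snd_reg_gram_inverse_t:
  assumes "X \<in> carrier_mat n d"
  shows "snd (reg_gram_inverse_t X lam) \<le> 2 * n * (d * d) + 8 * (d * (d * d))"
proof -
  have G: "transpose_mat X * X \<in> carrier_mat d d"
    using assms by auto
  have "snd (reg_gram_inverse_t X lam) =
      d * (d * (2 * n)) + (snd (add_diag_t (transpose_mat X * X) lam) + snd (inverse_t (reg_gram X lam)))"
    using assms fst_add_diag_t[OF G, of lam] by (simp add: reg_gram_inverse_t_def reg_gram_def)
  also have "\<dots> \<le> d * (d * (2 * n)) + (d * d + d * (d + 6 * (d * d)))"
    using snd_add_diag_t[of "transpose_mat X * X" lam] G assms
    by (intro add_mono snd_inverse_t) (auto simp: reg_gram_def)
  also have "\<dots> \<le> 2 * n * (d * d) + 8 * (d * (d * d))"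
    by (cases d) (auto simp: algebra_simps)
  finally show ?thesis .
qed

section \<open>Gauss--Jordan elimination\<close>

text \<open>The pair holds \<open>(B M, B)\<close> with \<open>B M\<close> injective and its first \<open>k\<close> columns reduced to unit vectors.\<close>

definition gauss_jordan_inv :: "nat \<Rightarrow> real mat \<Rightarrow> nat \<Rightarrow> real mat \<times> real mat \<Rightarrow> bool" where
  "gauss_jordan_inv d M k AB \<longleftrightarrow>
     fst AB \<in> carrier_mat d d \<and> snd AB \<in> carrier_mat d d \<and>
     (\<forall>i<d. \<forall>j<d. fst AB $$ (i, j) = (\<Sum>l<d. snd AB $$ (i, l) * M $$ (l, j))) \<and>
     (\<forall>y. (\<forall>i<d. (\<Sum>j<d. fst AB $$ (i, j) * y j) = 0) \<longrightarrow> (\<forall>j<d. y j = 0)) \<and>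
     (\<forall>i<d. \<forall>j<k. fst AB $$ (i, j) = (if i = j then 1 else 0))"

text \<open>The exchange acts by the same row permutation on both matrices, so it preserves the
  product relation and the kernel. Rows \<open>k\<close> and \<open>r\<close> both vanish in the
  columns before \<open>k\<close>, hence the reduced columns survive.\<close>

lemma gauss_jordan_inv_swaprows:
  assumes inv: "gauss_jordan_inv d M k (A, B)" and kr: "k \<le> r" "r < d"
  shows "gauss_jordan_inv d M k (swaprows k r A, swaprows k r B)"
proof -
  define \<pi> where "\<pi> = Fun.swap k r (id :: nat \<Rightarrow> nat)"
  have \<pi>: "\<pi> i < d" if "i < d" for i
    using that kr by (auto simp: \<pi>_def Transposition.transpose_def)
  have \<pi>\<pi>: "\<pi> (\<pi> i) = i" for i
    by (auto simp: \<pi>_def Transposition.transpose_def)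
  have swap: "swaprows k r N $$ (i, j) = N $$ (\<pi> i, j)" if "N \<in> carrier_mat d d" "i < d" "j < d" for N :: "real mat" and i j
    using that by (auto simp: \<pi>_def Transposition.transpose_def)
  have A: "A \<in> carrier_mat d d" and B: "B \<in> carrier_mat d d"
    using inv by (auto simp: gauss_jordan_inv_def)
  have prod: "A $$ (i, j) = (\<Sum>l<d. B $$ (i, l) * M $$ (l, j))" if "i < d" "j < d" for i j
    using inv that by (simp add: gauss_jordan_inv_def)
  have unit: "A $$ (i, j) = (if i = j then 1 else 0)" if "i < d" "j < k" for i j
    using inv that by (simp add: gauss_jordan_inv_def)
  have inj: "\<forall>j<d. y j = 0" if "\<And>i. i < d \<Longrightarrow> (\<Sum>j<d. A $$ (i, j) * y j) = 0" for y
    using inv that unfolding gauss_jordan_inv_def by auto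
  have "\<forall>j<d. y j = 0" if y: "\<forall>i<d. (\<Sum>j<d. swaprows k r A $$ (i, j) * y j) = 0" for y
  proof (rule inj)
    fix i assume "i < d"
    then show "(\<Sum>j<d. A $$ (i, j) * y j) = 0"
      using y[rule_format, OF \<pi>[OF \<open>i < d\<close>]] swap[OF A \<pi>[OF \<open>i < d\<close>]] by (simp add: \<pi>\<pi>)
  qed
  moreover have "swaprows k r A $$ (i, j) = (if i = j then 1 else 0)" if "i < d" "j < k" for i j
    using that kr unit[OF \<pi>[OF that(1)] that(2)]
    by (subst swap[OF A]) (auto simp: \<pi>_def Transposition.transpose_def)
  ultimately show ?thesis
    using A B by (auto simp: gauss_jordan_inv_def swap \<pi> prod simp del: index_mat_swaprows)
qed

lemma gauss_jordan_inv_pivot_exists: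
  assumes inv: "gauss_jordan_inv d M k (A, B)" and k: "k < d"
  shows "\<exists>r. k \<le> r \<and> r < d \<and> A $$ (r, k) \<noteq> 0"
proof (rule ccontr)
  assume none: "\<not> ?thesis"
  \<comment> \<open>Otherwise column \<open>k\<close> is a combination of the unit columns before it.\<close>
  define y where "y j = (if j = k then 1 else if j < k then - A $$ (j, k) else 0)" for j
  have unit: "A $$ (i, j) = (if i = j then 1 else 0)" if "i < d" "j < k" for i j
    using inv that by (simp add: gauss_jordan_inv_def)
  have "(\<Sum>j<d. A $$ (i, j) * y j) = 0" if i: "i < d" for i
  proof -
    have "(\<Sum>j<d. A $$ (i, j) * y j) =
        (\<Sum>j<d. (if j = k then A $$ (i, k) else 0) + (if j = i then if i < k then - A $$ (i, k) else 0 else 0))"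
      by (intro sum.cong) (auto simp: y_def unit i)
    also have "\<dots> = A $$ (i, k) + (if i < k then - A $$ (i, k) else 0)"
      using i k by (simp add: sum.distrib)
    also have "\<dots> = 0"
      using none i by (auto simp: not_less)
    finally show ?thesis .
  qed
  then have "y k = 0"
    using inv k unfolding gauss_jordan_inv_def by auto
  then show False
    by (simp add: y_def)
qed

text \<open>The step multiplies both matrices from the left by the same invertible matrix, which
  keeps the product relation and the trivial kernel while turning column \<open>k\<close> into a
  unit vector.\<close>

lemma gauss_jordan_inv_step:
  assumes inv: "gauss_jordan_inv d M k AB" and k: "k < d"
  shows "gauss_jordan_inv d M (Suc k) (fst (gauss_jordan_step_t k AB))"
proof -
  define r where "r = fst (pivot_t k (fst AB))"
  have dims: "fst AB \<in> carrier_mat d d" "snd AB \<in> carrier_mat d d"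
    using inv by (auto simp: gauss_jordan_inv_def)
  obtain r' where r': "k \<le> r'" "r' < d" "fst AB $$ (r', k) \<noteq> 0"
    using gauss_jordan_inv_pivot_exists[of d M k "fst AB" "snd AB"] inv k by auto
  \<comment> \<open>The pivot predicate is vacuous past the last row. The least solution is a
    genuine pivot because the nonzero entry in row \<open>r'\<close> lies within range and bounds
    it.\<close>
  define P where "P q \<longleftrightarrow> k \<le> q \<and> (q < d \<longrightarrow> fst AB $$ (q, k) \<noteq> 0)" for q
  have "P r'"
    using r' by (simp add: P_def)
  moreover have r_Least: "r = (LEAST q. P q)"
    using dims by (simp add: r_def fst_pivot_t P_def)
  ultimately have "P r" "r \<le> r'"
    using LeastI[of P] Least_le[of P] by auto
  then have r: "k \<le> r" "r < d" "fst AB $$ (r, k) \<noteq> 0"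
    using r' by (auto simp: P_def)
  define A where "A = swaprows k r (fst AB)"
  define B where "B = swaprows k r (snd AB)"
  define p where "p = A $$ (k, k)"
  define c where "c i = A $$ (i, k)" for i
  have inv': "gauss_jordan_inv d M k (A, B)"
    using gauss_jordan_inv_swaprows[of d M k "fst AB" "snd AB" r] inv r by (simp add: A_def B_def)
  have A: "A \<in> carrier_mat d d" and B: "B \<in> carrier_mat d d"
    using inv' by (auto simp: gauss_jordan_inv_def)
  have p: "p \<noteq> 0"
    using r dims k by (simp add: p_def A_def)
  have prod: "A $$ (i, j) = (\<Sum>l<d. B $$ (i, l) * M $$ (l, j))" if "i < d" "j < d" for i j
    using inv' that by (simp add: gauss_jordan_inv_def)
  have unit: "A $$ (i, j) = (if i = j then 1 else 0)" if "i < d" "j < k" for i j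
    using inv' that by (simp add: gauss_jordan_inv_def)
  have inj: "\<forall>j<d. y j = 0" if "\<And>i. i < d \<Longrightarrow> (\<Sum>j<d. A $$ (i, j) * y j) = 0" for y
    using inv' that unfolding gauss_jordan_inv_def by auto
  \<comment> \<open>\<open>E\<close> fuses scaling row \<open>k\<close> by \<open>p\<close> and
    clearing the other rows. Reading \<open>c\<close> before the scaling is harmless, since scaling
    changes row \<open>k\<close> only.\<close>
  define E where "E N = Matrix.mat d d (\<lambda>(i, j). if i = k then N $$ (k, j) / p
      else N $$ (i, j) - c i * (N $$ (k, j) / p))" for N :: "real mat"
  have step: "fst (gauss_jordan_step_t k AB) = (E A, E B)"
    unfolding gauss_jordan_step_t_def Let_def
    using A B k
    by (auto simp: r_def[symmetric] A_def[symmetric] B_def[symmetric] p_def[symmetric] E_def c_def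
        fst_scale_row_t fst_clear_rows_t intro!: eq_matI)
  have "E A $$ (i, j) = (\<Sum>l<d. E B $$ (i, l) * M $$ (l, j))" if "i < d" "j < d" for i j
    using that k
    by (auto simp: E_def prod sum_divide_distrib sum_distrib_left sum_subtractf[symmetric] algebra_simps
        intro!: sum.cong)
  moreover have "\<forall>j<d. y j = 0" if y: "\<And>i. i < d \<Longrightarrow> (\<Sum>j<d. E A $$ (i, j) * y j) = 0" for y
  proof (rule inj)
    fix i assume i: "i < d"
    \<comment> \<open>The row operations are undone: row \<open>k\<close> of \<open>A\<close> is
      \<open>p\<close> times that of \<open>E A\<close>, and any other row is that of
      \<open>E A\<close> plus a multiple of row \<open>k\<close> of \<open>A\<close>.\<close>
    have "(\<Sum>j<d. A $$ (k, j) * y j) = p * (\<Sum>j<d. E A $$ (k, j) * y j)"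
      unfolding sum_distrib_left by (intro sum.cong) (use k p in \<open>auto simp: E_def\<close>)
    then have k0: "(\<Sum>j<d. A $$ (k, j) * y j) = 0"
      using y[OF k] by simp
    have "(\<Sum>j<d. A $$ (i, j) * y j) = (\<Sum>j<d. E A $$ (i, j) * y j) + c i / p * (\<Sum>j<d. A $$ (k, j) * y j)"
      if "i \<noteq> k"
      unfolding sum_distrib_left sum.distrib[symmetric]
      by (intro sum.cong) (use i that in \<open>auto simp: E_def algebra_simps\<close>)
    then show "(\<Sum>j<d. A $$ (i, j) * y j) = 0"
      using k0 y[OF i] by (cases "i = k") auto
  qed
  moreover have "E A $$ (i, j) = (if i = j then 1 else 0)" if "i < d" "j < Suc k" for i j
  proof (cases "j = k")
    case True
    then show ?thesis
      using that p k by (auto simp: E_def p_def c_def)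
  next
    case False
    then show ?thesis
      using that k unit[of i j] unit[of k j] by (auto simp: E_def)
  qed
  moreover have "E A \<in> carrier_mat d d" "E B \<in> carrier_mat d d"
    by (auto simp: E_def)
  ultimately show ?thesis
    unfolding step gauss_jordan_inv_def by auto
qed

lemma gauss_jordan_t_inv:
  assumes "gauss_jordan_inv d M 0 AB" "k \<le> d"
  shows "gauss_jordan_inv d M k (fst (gauss_jordan_t k AB))"
  using assms(2) by (induction k) (use assms(1) gauss_jordan_inv_step in auto)

text \<open>After \<open>d\<close> steps the left matrix is the identity, while it still equals the
  right matrix times \<open>A\<close>. The determinant enters through the trivial kernel of
  \<open>A\<close>, which guarantees every pivot.\<close>

lemma inverse_t_correct:
  assumes A: "A \<in> carrier_mat d d" and det: "Determinant.det A \<noteq> 0"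
  shows "fst (inverse_t A) * A = 1\<^sub>m d"
proof -
  have "gauss_jordan_inv d A 0 (A, 1\<^sub>m d)"
  proof -
    have prod: "\<forall>i<d. \<forall>j<d. A $$ (i, j) = (\<Sum>l<d. 1\<^sub>m d $$ (i, l) * A $$ (l, j))"
    proof (intro allI impI)
      fix i j assume that: "i < d" "j < d"
      have "(\<Sum>l<d. 1\<^sub>m d $$ (i, l) * A $$ (l, j)) = (\<Sum>l<d. if l = i then A $$ (i, j) else 0)"
        by (intro sum.cong) (use that in auto)
      then show "A $$ (i, j) = (\<Sum>l<d. 1\<^sub>m d $$ (i, l) * A $$ (l, j))"
        using that by simp
    qed
    have inj: "\<forall>y. (\<forall>i<d. (\<Sum>j<d. A $$ (i, j) * y j) = 0) \<longrightarrow> (\<forall>j<d. y j = 0)"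
    proof (rule allI, rule impI)
      fix y assume that: "\<forall>i<d. (\<Sum>j<d. A $$ (i, j) * y j) = 0"
      have "A *\<^sub>v Matrix.vec d y = 0\<^sub>v d"
        by (rule eq_vecI) (use A that in \<open>auto simp: scalar_prod_def atLeast0LessThan\<close>)
      then have "Matrix.vec d y = 0\<^sub>v d"
        using det_0_iff_vec_prod_zero[OF A] det vec_carrier by blast
      then show "\<forall>j<d. y j = 0"
        by (metis index_vec index_zero_vec(1))
    qed
    show ?thesis
      unfolding gauss_jordan_inv_def fst_conv snd_conv
      by (intro conjI A one_carrier_mat prod inj) simp
  qed
  then have inv: "gauss_jordan_inv d A d (fst (gauss_jordan_t d (A, 1\<^sub>m d)))" (is "gauss_jordan_inv d A d ?LR")
    by (rule gauss_jordan_t_inv) simp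
  have LR: "snd ?LR \<in> carrier_mat d d"
    and prod: "\<forall>i<d. \<forall>j<d. fst ?LR $$ (i, j) = (\<Sum>l<d. snd ?LR $$ (i, l) * A $$ (l, j))"
    and unit: "\<forall>i<d. \<forall>j<d. fst ?LR $$ (i, j) = (if i = j then 1 else 0)"
    using inv unfolding gauss_jordan_inv_def by blast+
  have "snd ?LR * A = 1\<^sub>m d"
  proof (rule eq_matI)
    fix i j assume "i < dim_row (1\<^sub>m d :: real mat)" "j < dim_col (1\<^sub>m d :: real mat)"
    then have ij: "i < d" "j < d"
      by auto
    then have "(snd ?LR * A) $$ (i, j) = (\<Sum>l<d. snd ?LR $$ (i, l) * A $$ (l, j))"
      by (rule times_mat_index_eq_sum[OF LR A])
    also have "\<dots> = fst ?LR $$ (i, j)"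
      by (rule prod[rule_format, OF ij, symmetric])
    also have "\<dots> = 1\<^sub>m d $$ (i, j)"
      using unit ij by simp
    finally show "(snd ?LR * A) $$ (i, j) = 1\<^sub>m d $$ (i, j)" .
  qed (use A LR in auto)
  then show ?thesis
    using A by (simp add: inverse_t_def)
qed

section \<open>Regularized Gram matrices\<close>

definition outer_prod :: "nat \<Rightarrow> real vec \<Rightarrow> real vec \<Rightarrow> real mat" where
  "outer_prod d u v = Matrix.mat d d (\<lambda>(i, j). u $ i * v $ j)"

lemma outer_prod_carrier [simp]: "outer_prod d u v \<in> carrier_mat d d"
  by (simp add: outer_prod_def)

lemma outer_prod_index [simp]: "i < d \<Longrightarrow> j < d \<Longrightarrow> outer_prod d u v $$ (i, j) = u $ i * v $ j"
  by (simp add: outer_prod_def)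

lemma outer_prod_dim [simp]: "dim_row (outer_prod d u v) = d" "dim_col (outer_prod d u v) = d"
  by (simp_all add: outer_prod_def)

lemma scalar_prod_self_nonneg: "0 \<le> (v :: real vec) \<bullet> v"
  by (auto simp: scalar_prod_def intro!: sum_nonneg)

lemma bilinear_form_eq_sum:
  fixes A :: "real mat"
  assumes "A \<in> carrier_mat d d" "u \<in> carrier_vec d" "v \<in> carrier_vec d"
  shows "u \<bullet> (A *\<^sub>v v) = (\<Sum>a<d. \<Sum>b<d. u $ a * A $$ (a, b) * v $ b)"
  using assms by (auto simp: scalar_prod_def atLeast0LessThan sum_distrib_left mult.assoc intro!: sum.cong)

text \<open>The bordered matrix with blocks \<open>A\<close>, \<open>u\<close>, \<open>v\<close> (transposed) and \<open>1\<close> is factored in two ways.\<close>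

lemma det_minus_outer_prod:
  assumes A: "A \<in> carrier_mat d d" and Z: "Z \<in> carrier_mat d d" and AZ: "A * Z = 1\<^sub>m d"
    and u: "u \<in> carrier_vec d" and v: "v \<in> carrier_vec d"
  shows "Determinant.det (A - outer_prod d u v) = Determinant.det A * (1 - v \<bullet> (Z *\<^sub>v u))"
proof -
  define U where "U = Matrix.mat d 1 (\<lambda>(i, j). u $ i)"
  define V where "V = Matrix.mat 1 d (\<lambda>(i, j). v $ j)"
  define I where "I = (1\<^sub>m 1 :: real mat)"
  \<comment> \<open>\<open>D\<close> is the Schur complement of \<open>A\<close> in the bordered
    matrix, as \<open>A - outer_prod d u v\<close> is that of the corner entry 1. Equating the two
    determinants gives the claim.\<close>
  define D where "D = I - V * (Z * U)"
  have car [simp]: "U \<in> carrier_mat d 1" "V \<in> carrier_mat 1 d" "I \<in> carrier_mat 1 1" "D \<in> carrier_mat 1 1"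
    using Z by (auto simp: U_def V_def I_def D_def)
  let ?P = "four_block_mat (A - outer_prod d u v) U (0\<^sub>m 1 d) I"
  let ?Q = "four_block_mat (1\<^sub>m d) (0\<^sub>m d 1) V I"
  let ?R = "four_block_mat A (0\<^sub>m d 1) V I"
  let ?T = "four_block_mat (1\<^sub>m d) (Z * U) (0\<^sub>m 1 d) D"
  have AO: "A - outer_prod d u v \<in> carrier_mat d d"
    using A by auto
  have UV: "U * V = outer_prod d u v"
    by (rule eq_matI) (auto simp: U_def V_def scalar_prod_def)
  have "?P * ?Q = four_block_mat ((A - outer_prod d u v) * 1\<^sub>m d + U * V)
      ((A - outer_prod d u v) * 0\<^sub>m d 1 + U * I) (0\<^sub>m 1 d * 1\<^sub>m d + I * V) (0\<^sub>m 1 d * 0\<^sub>m d 1 + I * I)"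
    by (rule mult_four_block_mat[OF AO car(1) zero_carrier_mat car(3) one_carrier_mat zero_carrier_mat car(2,3)])
  also have "\<dots> = four_block_mat A U V I"
  proof -
    have "(A - outer_prod d u v) * 1\<^sub>m d + U * V = A"
      unfolding UV using A by (intro eq_matI) auto
    moreover have "U * I = U"
      unfolding I_def by (rule right_mult_one_mat[OF car(1)])
    then have "(A - outer_prod d u v) * 0\<^sub>m d 1 + U * I = U"
      using AO left_add_zero_mat[OF car(1)] by simp
    moreover have "0\<^sub>m 1 d * 1\<^sub>m d + I * V = V" "0\<^sub>m 1 d * 0\<^sub>m d 1 + I * I = I"
      by (auto simp: I_def V_def)
    ultimately show ?thesis
      by simp
  qed
  finally have PQ: "?P * ?Q = four_block_mat A U V I" .
  have ZU: "Z * U \<in> carrier_mat d 1"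
    by (rule mult_carrier_mat[OF Z car(1)])
  have "?R * ?T = four_block_mat (A * 1\<^sub>m d + 0\<^sub>m d 1 * 0\<^sub>m 1 d) (A * (Z * U) + 0\<^sub>m d 1 * D)
      (V * 1\<^sub>m d + I * 0\<^sub>m 1 d) (V * (Z * U) + I * D)"
    by (rule mult_four_block_mat[OF A zero_carrier_mat car(2,3) one_carrier_mat ZU zero_carrier_mat car(4)])
  also have "\<dots> = four_block_mat A U V I"
  proof -
    have "A * (Z * U) = U"
      using assoc_mult_mat[OF A Z car(1)] AZ left_mult_one_mat[OF car(1)] by simp
    then have "A * (Z * U) + 0\<^sub>m d 1 * D = U"
      unfolding left_mult_zero_mat[OF car(4)] using right_add_zero_mat[OF car(1)] by simp
    moreover have "A * 1\<^sub>m d + 0\<^sub>m d 1 * 0\<^sub>m 1 d = A"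
      using A by simp
    moreover have "V * 1\<^sub>m d + I * 0\<^sub>m 1 d = V"
      unfolding right_mult_zero_mat[OF car(3)] right_mult_one_mat[OF car(2)] by (rule right_add_zero_mat[OF car(2)])
    moreover have "I * D = D"
      unfolding I_def by (rule left_mult_one_mat[OF car(4)])
    then have "V * (Z * U) + I * D = I"
      using mult_carrier_mat[OF car(2) ZU] by (intro eq_matI) (auto simp: D_def I_def carrier_matD[OF car(1)] carrier_matD[OF car(2)])
    ultimately show ?thesis
      by simp
  qed
  finally have RT: "?R * ?T = four_block_mat A U V I" .
  have carP: "?P \<in> carrier_mat (d + 1) (d + 1)" "?Q \<in> carrier_mat (d + 1) (d + 1)"
    "?R \<in> carrier_mat (d + 1) (d + 1)" "?T \<in> carrier_mat (d + 1) (d + 1)"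
    by (rule four_block_carrier_mat[OF AO car(3)] four_block_carrier_mat[OF A car(3)]
        four_block_carrier_mat[OF one_carrier_mat car(3)] four_block_carrier_mat[OF one_carrier_mat car(4)])+
  have I1: "Determinant.det I = 1"
    by (simp add: I_def)
  have "Determinant.det ?P = Determinant.det (A - outer_prod d u v)"
    unfolding det_four_block_mat_lower_left_zero[OF AO car(1) refl car(3)] by (simp add: I1)
  moreover have "Determinant.det ?Q = 1"
    unfolding det_four_block_mat_upper_right_zero[OF one_carrier_mat refl car(2,3)] by (simp add: I1)
  moreover have "Determinant.det ?R = Determinant.det A"
    unfolding det_four_block_mat_upper_right_zero[OF A refl car(2,3)] by (simp add: I1)
  moreover have "Determinant.det ?T = Determinant.det D"
    unfolding det_four_block_mat_lower_left_zero[OF one_carrier_mat ZU refl car(4)] by simp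
  ultimately have "Determinant.det (A - outer_prod d u v) = Determinant.det A * Determinant.det D"
    using det_mult[OF carP(1,2)] det_mult[OF carP(3,4)] PQ RT by simp
  also have "Determinant.det D = D $$ (0, 0)"
    by (rule det_single[OF car(4)])
  also have "\<dots> = 1 - v \<bullet> (Z *\<^sub>v u)"
  proof -
    have "Matrix.col U 0 = u" "Matrix.row V 0 = v"
      using u v by (auto simp: U_def V_def)
    moreover have "Matrix.col (Z * U) 0 = Z *\<^sub>v Matrix.col U 0"
      by (rule eq_vecI) (use Z in \<open>auto simp: U_def\<close>)
    ultimately show ?thesis
      by (simp add: D_def I_def carrier_matD[OF car(1)] carrier_matD[OF car(2)])
  qed
  finally show ?thesis .
qed

text \<open>Turns sums over row positions of a submatrix into sums over the original labels. An
  injection into \<open>S\<close> from a set of the same finite cardinality is onto.\<close>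

lemma bij_betw_pick:
  assumes "finite S"
  shows "bij_betw (pick S) {..<card S} S"
proof -
  have inj: "inj_on (pick S) {..<card S}"
    by (rule linorder_inj_onI') (metis lessThan_iff less_irrefl pick_mono_le)
  moreover have "pick S ` {..<card S} \<subseteq> S"
    using pick_in_set_le by auto
  then have "pick S ` {..<card S} = S"
    using assms card_image[OF inj] by (intro card_subset_eq) auto
  ultimately show ?thesis
    by (simp add: bij_betw_def)
qed

section \<open>Gram matrices of sets of rows\<close>

locale regularized_rows =
  fixes X :: "real mat" and n d :: nat and lam :: real
  assumes X: "X \<in> carrier_mat n d" and lam: "0 \<le> lam"
begin

abbreviation gram :: "nat set \<Rightarrow> real mat" where
  "gram S \<equiv> reg_gram (row_submatrix X S) lam"

abbreviation x :: "nat \<Rightarrow> real vec" where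
  "x i \<equiv> Matrix.row X i"

lemma x_carrier [simp]: "x i \<in> carrier_vec d"
  using X by auto

lemma X_dims [simp]: "dim_row X = n" "dim_col X = d"
  using X by auto

lemma row_submatrix_carrier:
  assumes "S \<subseteq> {..<n}"
  shows "row_submatrix X S \<in> carrier_mat (card S) d"
proof -
  have "{i. i < n \<and> i \<in> S} = S"
    using assms by auto
  then show ?thesis
    using carrier_matD[OF X] by (intro carrier_matI) (simp_all add: row_submatrix_def dim_submatrix)
qed

lemma row_submatrix_UNIV: "row_submatrix X {..<n} = X"
proof (rule eq_matI)
  fix i j assume "i < dim_row X" "j < dim_col X"
  moreover have "{a. a < n \<and> a < i} = {..<i}" "{a :: nat. a < j} = {..<j}" if "i < n"
    using that by auto
  ultimately show "row_submatrix X {..<n} $$ (i, j) = X $$ (i, j)"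
    using X submatrix_index_card[of i X j "{..<n}" UNIV] by (simp add: row_submatrix_def)
qed (use X row_submatrix_carrier[of "{..<n}"] in auto)

lemma gram_dim [simp]: "gram S \<in> carrier_mat d d"
  using carrier_matD[OF X] by (intro carrier_matI) (simp_all add: reg_gram_def row_submatrix_def dim_submatrix)

lemma gram_dims [simp]: "dim_row (gram S) = d" "dim_col (gram S) = d"
  using gram_dim by (rule carrier_matD)+

text \<open>Written over labels, the entry does not depend on row positions in the submatrix, so
  deleting a row just deletes one summand.\<close>

lemma gram_index:
  assumes S: "S \<subseteq> {..<n}" and ab: "a < d" "b < d"
  shows "gram S $$ (a, b) = (\<Sum>i\<in>S. x i $ a * x i $ b) + (if a = b then lam else 0)"
proof -
  have fin: "finite S"
    using S finite_subset by auto
  have car: "row_submatrix X S \<in> carrier_mat (card S) d"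
    by (rule row_submatrix_carrier[OF S])
  have S': "{i. i < n \<and> i \<in> S} = S"
    using S by auto
  have entry: "row_submatrix X S $$ (k, c) = x (pick S k) $ c" if "k < card S" "c < d" for k c
  proof -
    have "pick S k < n"
      using pick_in_set_le[OF that(1)] S by auto
    then show ?thesis
      using that X S' by (simp add: row_submatrix_def submatrix_index pick_UNIV)
  qed
  have "gram S $$ (a, b) = (\<Sum>k<card S. row_submatrix X S $$ (k, a) * row_submatrix X S $$ (k, b))
      + (if a = b then lam else 0)"
    using car ab by (auto simp: reg_gram_def scalar_prod_def atLeast0LessThan)
  also have "(\<Sum>k<card S. row_submatrix X S $$ (k, a) * row_submatrix X S $$ (k, b)) =
      (\<Sum>k<card S. x (pick S k) $ a * x (pick S k) $ b)"
    using ab by (simp add: entry)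
  also have "\<dots> = (\<Sum>i\<in>S. x i $ a * x i $ b)"
    by (rule sum.reindex_bij_betw[OF bij_betw_pick[OF fin]])
  finally show ?thesis .
qed

lemma gram_sym:
  assumes "S \<subseteq> {..<n}"
  shows "transpose_mat (gram S) = gram S"
  by (intro eq_matI) (auto simp: gram_index[OF assms] mult.commute)

lemma gram_remove:
  assumes S: "S \<subseteq> {..<n}" and i: "i \<in> S"
  shows "gram (S - {i}) = gram S - outer_prod d (x i) (x i)"
proof (rule eq_matI)
  have S': "S - {i} \<subseteq> {..<n}" and "finite S"
    using S finite_subset by auto
  fix a b assume "a < dim_row (gram S - outer_prod d (x i) (x i))" "b < dim_col (gram S - outer_prod d (x i) (x i))"
  then have ab: "a < d" "b < d"
    by auto
  then show "gram (S - {i}) $$ (a, b) = (gram S - outer_prod d (x i) (x i)) $$ (a, b)"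
    using sum.remove[OF \<open>finite S\<close> i, of "\<lambda>i. x i $ a * x i $ b"]
    by (simp add: gram_index[OF S] gram_index[OF S'] del: index_row)
qed auto

text \<open>This sum of squares is the source of all positivity below: the bounds on removal
  weights, the sign of the trace of the inverse, and nonsingularity.\<close>

lemma gram_quadratic_form:
  assumes S: "S \<subseteq> {..<n}" and y: "y \<in> carrier_vec d"
  shows "y \<bullet> (gram S *\<^sub>v y) = (\<Sum>i\<in>S. (x i \<bullet> y)\<^sup>2) + lam * (y \<bullet> y)"
proof -
  have "y \<bullet> (gram S *\<^sub>v y) = (\<Sum>a<d. \<Sum>b<d. y $ a * gram S $$ (a, b) * y $ b)"
    by (rule bilinear_form_eq_sum[OF gram_dim y y])
  also have "\<dots> = (\<Sum>a<d. \<Sum>b<d. (\<Sum>i\<in>S. (x i $ a * y $ a) * (x i $ b * y $ b)) + (if b = a then lam * (y $ a * y $ a) else 0))"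
    by (intro sum.cong) (auto simp: gram_index[OF S] algebra_simps sum_distrib_left simp del: index_row)
  also have "\<dots> = (\<Sum>a<d. \<Sum>b<d. \<Sum>i\<in>S. (x i $ a * y $ a) * (x i $ b * y $ b)) + (\<Sum>a<d. lam * (y $ a * y $ a))"
    by (simp add: sum.distrib del: index_row)
  also have "(\<Sum>a<d. \<Sum>b<d. \<Sum>i\<in>S. (x i $ a * y $ a) * (x i $ b * y $ b)) = (\<Sum>a<d. \<Sum>i\<in>S. \<Sum>b<d. (x i $ a * y $ a) * (x i $ b * y $ b))"
    by (intro sum.cong refl sum.swap)
  also have "\<dots> = (\<Sum>i\<in>S. \<Sum>a<d. \<Sum>b<d. (x i $ a * y $ a) * (x i $ b * y $ b))"
    by (rule sum.swap)
  also have "\<dots> = (\<Sum>i\<in>S. (x i \<bullet> y)\<^sup>2)"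
    using y by (simp add: power2_eq_square scalar_prod_def atLeast0LessThan sum_product del: index_row)
  also have "(\<Sum>a<d. lam * (y $ a * y $ a)) = lam * (y \<bullet> y)"
    using y by (simp add: scalar_prod_def atLeast0LessThan sum_distrib_left)
  finally show ?thesis .
qed

section \<open>Inverse Gram matrices and removal weights\<close>

definition inv_gram :: "nat set \<Rightarrow> real mat \<Rightarrow> bool" where
  "inv_gram S Z \<longleftrightarrow> S \<subseteq> {..<n} \<and> Z \<in> carrier_mat d d \<and> Z * gram S = 1\<^sub>m d"

definition removal_weight :: "real mat \<Rightarrow> nat \<Rightarrow> real" where
  "removal_weight Z i = 1 - x i \<bullet> (Z *\<^sub>v x i)"

text \<open>The left inverse demanded by the invariant is two-sided since the matrices are square,
  and it certifies that the Gram matrix is nonsingular. Its transpose is a left inverse of the same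
  symmetric matrix, so uniqueness makes it symmetric.\<close>

lemma inv_gramD:
  assumes "inv_gram S Z"
  shows "S \<subseteq> {..<n}" "finite S" "Z \<in> carrier_mat d d" "Z * gram S = 1\<^sub>m d" "gram S * Z = 1\<^sub>m d"
    "Determinant.det (gram S) \<noteq> 0" "transpose_mat Z = Z"
proof -
  show S: "S \<subseteq> {..<n}" and Z: "Z \<in> carrier_mat d d" and ZG: "Z * gram S = 1\<^sub>m d"
    using assms by (auto simp: inv_gram_def)
  show "finite S"
    using S finite_subset by auto
  show GZ: "gram S * Z = 1\<^sub>m d"
    by (rule mat_mult_left_right_inverse[OF Z gram_dim ZG])
  have "Determinant.det Z * Determinant.det (gram S) = 1"
    using det_mult[OF Z gram_dim[of S]] ZG by simp
  then show "Determinant.det (gram S) \<noteq> 0"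
    by auto
  have Zt: "transpose_mat Z \<in> carrier_mat d d"
    using Z by auto
  have "transpose_mat Z * gram S = 1\<^sub>m d"
    using transpose_mult[OF gram_dim[of S] Z] GZ gram_sym[OF S] by simp
  then have "transpose_mat Z = (transpose_mat Z * gram S) * Z"
    using assoc_mult_mat[OF Zt gram_dim[of S] Z] GZ Zt by simp
  then show "transpose_mat Z = Z"
    using \<open>transpose_mat Z * gram S = 1\<^sub>m d\<close> Z by simp
qed

lemma inv_gram_index_sym:
  assumes "inv_gram S Z" "a < d" "b < d"
  shows "Z $$ (a, b) = Z $$ (b, a)"
  using inv_gramD(3,7)[OF assms(1)] assms(2,3) by (metis carrier_matD index_transpose_mat(1))

lemma det_gram_remove:
  assumes inv: "inv_gram S Z" and i: "i \<in> S"
  shows "Determinant.det (gram (S - {i})) = Determinant.det (gram S) * removal_weight Z i"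
  using det_minus_outer_prod[OF gram_dim inv_gramD(3,5)[OF inv] x_carrier x_carrier]
    gram_remove[OF inv_gramD(1)[OF inv] i] by (simp add: removal_weight_def)

text \<open>Substitute \<open>y = Z *\<^sub>v v\<close> into the quadratic form of the Gram matrix,
  which maps \<open>y\<close> back to \<open>v\<close>.\<close>

lemma inv_gram_quadratic_form:
  assumes inv: "inv_gram S Z" and v: "v \<in> carrier_vec d"
  shows "v \<bullet> (Z *\<^sub>v v) = (\<Sum>j\<in>S. (x j \<bullet> (Z *\<^sub>v v))\<^sup>2) + lam * ((Z *\<^sub>v v) \<bullet> (Z *\<^sub>v v))"
proof -
  note Z = inv_gramD(3)[OF inv]
  have y: "Z *\<^sub>v v \<in> carrier_vec d"
    using Z v by auto
  have "gram S *\<^sub>v (Z *\<^sub>v v) = v"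
    using assoc_mult_mat_vec[OF gram_dim[of S] Z v] inv_gramD(5)[OF inv] v by simp
  then show ?thesis
    using gram_quadratic_form[OF inv_gramD(1)[OF inv] y] comm_scalar_prod[OF v y] by simp
qed

lemma inv_gram_quadratic_form_nonneg:
  assumes inv: "inv_gram S Z" and v: "v \<in> carrier_vec d"
  shows "0 \<le> v \<bullet> (Z *\<^sub>v v)"
  unfolding inv_gram_quadratic_form[OF inv v] using lam
  by (intro add_nonneg_nonneg sum_nonneg mult_nonneg_nonneg) (auto simp: scalar_prod_def intro!: sum_nonneg)

text \<open>Expand q = x_i . Z x_i as a sum of nonnegative terms. The term for \<open>j = i\<close>
  is q^2 itself, so q^2 <= q, which places q between 0 and 1.\<close>

lemma removal_weight_bounds:
  assumes inv: "inv_gram S Z" and i: "i \<in> S"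
  shows "0 \<le> removal_weight Z i" "removal_weight Z i \<le> 1"
proof -
  define q where "q = x i \<bullet> (Z *\<^sub>v x i)"
  have "q\<^sup>2 \<le> (\<Sum>j\<in>S. (x j \<bullet> (Z *\<^sub>v x i))\<^sup>2)"
    unfolding q_def using inv_gramD(2)[OF inv] i by (intro member_le_sum) auto
  also have "\<dots> \<le> q"
    unfolding q_def inv_gram_quadratic_form[OF inv x_carrier[of i]] using lam
    by (simp add: scalar_prod_self_nonneg)
  finally have "q * q \<le> 1 * q"
    by (simp add: power2_eq_square)
  moreover have "0 \<le> q"
    unfolding q_def by (rule inv_gram_quadratic_form_nonneg[OF inv x_carrier])
  ultimately have "q \<le> 1"
    by (cases "q = 0") (auto dest: mult_right_le_imp_le)
  with \<open>0 \<le> q\<close> show "0 \<le> removal_weight Z i" "removal_weight Z i \<le> 1"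
    by (simp_all add: removal_weight_def q_def)
qed

text \<open>After exchanging sums, the terms x_i . Z x_i add up to the trace of Z (G - lam I), where
  Z G is the identity.\<close>

lemma sum_removal_weight:
  assumes inv: "inv_gram S Z"
  shows "(\<Sum>i\<in>S. removal_weight Z i) = real (card S) - real d + lam * (\<Sum>a<d. Z $$ (a, a))"
proof -
  note Z = inv_gramD(3)[OF inv]
  have "(\<Sum>i\<in>S. x i \<bullet> (Z *\<^sub>v x i)) = (\<Sum>i\<in>S. \<Sum>a<d. \<Sum>b<d. Z $$ (a, b) * (x i $ b * x i $ a))"
    unfolding bilinear_form_eq_sum[OF Z x_carrier x_carrier] by (simp add: mult_ac del: index_row)
  also have "\<dots> = (\<Sum>a<d. \<Sum>i\<in>S. \<Sum>b<d. Z $$ (a, b) * (x i $ b * x i $ a))"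
    by (rule sum.swap)
  also have "\<dots> = (\<Sum>a<d. \<Sum>b<d. \<Sum>i\<in>S. Z $$ (a, b) * (x i $ b * x i $ a))"
    by (intro sum.cong refl sum.swap)
  also have "\<dots> = (\<Sum>a<d. \<Sum>b<d. Z $$ (a, b) * gram S $$ (b, a) - (if b = a then lam * Z $$ (a, a) else 0))"
    by (intro sum.cong) (auto simp: gram_index[OF inv_gramD(1)[OF inv]] sum_distrib_left distrib_left simp del: index_row)
  also have "\<dots> = (\<Sum>a<d. (Z * gram S) $$ (a, a) - lam * Z $$ (a, a))"
    by (intro sum.cong) (auto simp: sum_subtractf times_mat_index_eq_sum[OF Z gram_dim])
  also have "\<dots> = real d - lam * (\<Sum>a<d. Z $$ (a, a))"
    unfolding inv_gramD(4)[OF inv] by (simp add: sum_subtractf sum_distrib_left)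
  finally show ?thesis
    by (simp add: removal_weight_def sum_subtractf)
qed

lemma sum_removal_weight_ge:
  assumes inv: "inv_gram S Z"
  shows "real (card S) - real d \<le> (\<Sum>i\<in>S. removal_weight Z i)"
proof -
  note Z = inv_gramD(3)[OF inv]
  have "0 \<le> Z $$ (a, a)" if "a < d" for a
  proof -
    have "unit_vec d a \<bullet> (Z *\<^sub>v unit_vec d a) = Z $$ (a, a)"
      using Z that by simp
    then show ?thesis
      using inv_gram_quadratic_form_nonneg[OF inv, of "unit_vec d a"] by simp
  qed
  then show ?thesis
    unfolding sum_removal_weight[OF inv] using lam by (auto intro!: mult_nonneg_nonneg sum_nonneg)
qed

text \<open>The Sherman--Morrison formula.\<close>

definition update :: "real mat \<Rightarrow> nat \<Rightarrow> real mat" where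
  "update Z i = Matrix.mat d d (\<lambda>(a, b). Z $$ (a, b) + (Z *\<^sub>v x i) $ a * (Z *\<^sub>v x i) $ b / removal_weight Z i)"

lemma update_carrier [simp]: "update Z i \<in> carrier_mat d d"
  by (simp add: update_def)

text \<open>Write u = Z x_i and h for the weight. Symmetry gives u^T G = x_i^T, and u . x_i = 1 - h.
  Multiplying out (Z + u u^T / h) (G - x_i x_i^T), what is added to the identity is -u x_i^T + (u /
  h) (x_i^T - (1 - h) x_i^T) = 0.\<close>

lemma inv_gram_update:
  assumes inv: "inv_gram S Z" and i: "i \<in> S" and h: "removal_weight Z i \<noteq> 0"
  shows "inv_gram (S - {i}) (update Z i)"
proof -
  note Z = inv_gramD(3)[OF inv] and S = inv_gramD(1)[OF inv]
  define h where "h = removal_weight Z i"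
  define u where "u = Z *\<^sub>v x i"
  have u: "u \<in> carrier_vec d"
    using Z by (auto simp: u_def)
  have ZG: "(\<Sum>c<d. Z $$ (a, c) * gram S $$ (c, b)) = (if a = b then 1 else 0)" if "a < d" "b < d" for a b
  proof -
    have "(\<Sum>c<d. Z $$ (a, c) * gram S $$ (c, b)) = (Z * gram S) $$ (a, b)"
      using times_mat_index_eq_sum[OF Z gram_dim that] by simp
    then show ?thesis
      using that by (simp add: inv_gramD(4)[OF inv])
  qed
  have u_index: "u $ a = (\<Sum>c<d. Z $$ (a, c) * x i $ c)" if "a < d" for a
    using that Z by (simp add: u_def scalar_prod_def atLeast0LessThan)
  have uG: "(\<Sum>c<d. u $ c * gram S $$ (c, b)) = x i $ b" if b: "b < d" for b
  proof -
    have "(\<Sum>c<d. u $ c * gram S $$ (c, b)) = (\<Sum>c<d. \<Sum>e<d. Z $$ (e, c) * x i $ e * gram S $$ (c, b))"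
      by (intro sum.cong) (auto simp: u_index sum_distrib_right inv_gram_index_sym[OF inv] simp del: index_row intro!: sum.cong)
    also have "\<dots> = (\<Sum>e<d. \<Sum>c<d. Z $$ (e, c) * x i $ e * gram S $$ (c, b))"
      by (rule sum.swap)
    also have "\<dots> = (\<Sum>e<d. x i $ e * (\<Sum>c<d. Z $$ (e, c) * gram S $$ (c, b)))"
      by (simp add: sum_distrib_left mult_ac del: index_row)
    also have "\<dots> = (\<Sum>e<d. if e = b then x i $ b else 0)"
      by (intro sum.cong) (auto simp: ZG b)
    finally show ?thesis
      using b by simp
  qed
  have ux: "(\<Sum>c<d. u $ c * x i $ c) = 1 - h"
    using comm_scalar_prod[OF u x_carrier[of i]]
    by (simp add: h_def removal_weight_def u_def[symmetric] scalar_prod_def atLeast0LessThan)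
  have "update Z i * gram (S - {i}) = 1\<^sub>m d"
  proof (rule eq_matI)
    fix a b assume "a < dim_row (1\<^sub>m d :: real mat)" "b < dim_col (1\<^sub>m d :: real mat)"
    then have ab: "a < d" "b < d"
      by auto
    have "(update Z i * gram (S - {i})) $$ (a, b) =
        (\<Sum>c<d. (Z $$ (a, c) + u $ a * u $ c / h) * (gram S $$ (c, b) - x i $ c * x i $ b))"
      using ab by (simp add: times_mat_index_eq_sum[OF update_carrier gram_dim] del: index_mult_mat index_row)
        (simp add: gram_remove[OF S i] update_def u_def[symmetric] h_def[symmetric] del: index_row)
    also have "\<dots> = (\<Sum>c<d. Z $$ (a, c) * gram S $$ (c, b)) - (\<Sum>c<d. Z $$ (a, c) * x i $ c) * x i $ b
        + u $ a / h * ((\<Sum>c<d. u $ c * gram S $$ (c, b)) - (\<Sum>c<d. u $ c * x i $ c) * x i $ b)"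
      by (simp add: sum_distrib_left sum_distrib_right sum_subtractf[symmetric] sum.distrib[symmetric] algebra_simps
          del: index_row)
    also have "\<dots> = (if a = b then 1 else 0)"
      using h by (simp add: ZG uG ux u_index[symmetric] ab h_def[symmetric] field_simps del: index_row)
    finally show "(update Z i * gram (S - {i})) $$ (a, b) = 1\<^sub>m d $$ (a, b)"
      using ab by simp
  qed (auto simp: update_def)
  then show ?thesis
    using S by (auto simp: inv_gram_def)
qed

text \<open>RegVol never recomputes its weights. By this identity, subtracting the square of x_j . v
  keeps them equal to the removal weights of the updated inverse.\<close>

lemma removal_weight_update:
  assumes Z: "Z \<in> carrier_mat d d"
  shows "removal_weight (update Z i) j = removal_weight Z j - (x j \<bullet> (Z *\<^sub>v x i))\<^sup>2 / removal_weight Z i"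
proof -
  define u where "u = Z *\<^sub>v x i"
  have u: "u \<in> carrier_vec d"
    using Z by (auto simp: u_def)
  have "x j \<bullet> (update Z i *\<^sub>v x j) =
      (\<Sum>a<d. \<Sum>b<d. x j $ a * Z $$ (a, b) * x j $ b + (x j $ a * u $ a) * (x j $ b * u $ b) / removal_weight Z i)"
    unfolding bilinear_form_eq_sum[OF update_carrier x_carrier x_carrier]
    by (intro sum.cong) (auto simp: update_def u_def[symmetric] algebra_simps add_divide_distrib simp del: index_row)
  also have "\<dots> = x j \<bullet> (Z *\<^sub>v x j) + (\<Sum>a<d. x j $ a * u $ a) * (\<Sum>b<d. x j $ b * u $ b) / removal_weight Z i"
    unfolding bilinear_form_eq_sum[OF Z x_carrier x_carrier] sum_product
    by (simp add: sum.distrib sum_divide_distrib del: index_row)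
  also have "(\<Sum>a<d. x j $ a * u $ a) = x j \<bullet> u"
    using u by (simp add: scalar_prod_def atLeast0LessThan)
  finally show ?thesis
    by (simp add: removal_weight_def u_def power2_eq_square)
qed

section \<open>Nonsingular Gram matrices\<close>

lemma det_gram_nonzeroI:
  assumes "\<And>y. y \<in> carrier_vec d \<Longrightarrow> y \<bullet> (gram S *\<^sub>v y) = 0 \<Longrightarrow> y = 0\<^sub>v d"
  shows "Determinant.det (gram S) \<noteq> 0"
  using assms det_0_iff_vec_prod_zero[OF gram_dim[of S]] by fastforce

text \<open>The ridge term alone makes the quadratic form definite, so any set of rows will do, even
  the empty one.\<close>

lemma det_gram_nonzero_regularized:
  assumes S: "S \<subseteq> {..<n}" and "0 < lam"
  shows "Determinant.det (gram S) \<noteq> 0"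
proof (rule det_gram_nonzeroI)
  fix y assume y: "y \<in> carrier_vec d" and "y \<bullet> (gram S *\<^sub>v y) = 0"
  moreover have "0 \<le> (\<Sum>i\<in>S. (x i \<bullet> y)\<^sup>2)" "0 \<le> y \<bullet> y"
    by (auto intro!: sum_nonneg scalar_prod_self_nonneg)
  ultimately have "lam * (y \<bullet> y) = 0"
    using gram_quadratic_form[OF S y] lam by (simp add: add_nonneg_eq_0_iff)
  then have "(\<Sum>a<d. y $ a * y $ a) = 0"
    using y \<open>0 < lam\<close> by (simp add: scalar_prod_def atLeast0LessThan)
  then have "\<forall>a<d. y $ a = 0"
    by (subst (asm) sum_nonneg_eq_0_iff) auto
  then show "y = 0\<^sub>v d"
    using y by (intro eq_vecI) auto
qed

lemma det_gram_nonzero_full_rank: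
  assumes rank: "vec_space.rank n X = d"
  shows "Determinant.det (gram {..<n}) \<noteq> 0"
proof (rule det_gram_nonzeroI)
  interpret vec_space "TYPE(real)" n .
  \<comment> \<open>Linear independence concerns the set of columns. A repeated column would leave
    fewer than \<open>d\<close> members, and the rank, being the size of a maximal independent
    subset, would drop below \<open>d\<close>.\<close>
  have dist: "distinct (cols X)"
  proof (rule ccontr)
    assume "\<not> distinct (cols X)"
    then have "card (set (cols X)) < d"
      using X card_length[of "cols X"] card_distinct[of "cols X"] by (auto simp: le_less)
    moreover obtain T where T: "maximal T (\<lambda>T. T \<subseteq> set (cols X) \<and> lin_indpt T)"
      using maximal_exists[of "(\<lambda>T. T \<subseteq> set (cols X) \<and> lin_indpt T)" "card (set (cols X))" "{}"]
      by (meson List.finite_set card_mono empty_iff empty_subsetI finite_lin_indpt2 rev_finite_subset)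
    moreover have "card T \<le> card (set (cols X))"
      using T by (intro card_mono) (auto simp: maximal_def)
    ultimately show False
      using rank_card_indpt[OF X T] rank by simp
  qed
  fix y assume y: "y \<in> carrier_vec d" and "y \<bullet> (gram {..<n} *\<^sub>v y) = 0"
  moreover have nonneg: "0 \<le> (\<Sum>i<n. (x i \<bullet> y)\<^sup>2)" "0 \<le> lam * (y \<bullet> y)"
    using lam by (auto intro!: sum_nonneg mult_nonneg_nonneg scalar_prod_self_nonneg)
  ultimately have "(\<Sum>i<n. (x i \<bullet> y)\<^sup>2) = 0"
    using gram_quadratic_form[OF order_refl y] by (simp add: add_nonneg_eq_0_iff)
  then have "\<forall>i<n. x i \<bullet> y = 0"
    by (subst (asm) sum_nonneg_eq_0_iff) auto
  then have "X *\<^sub>v y = 0\<^sub>v n"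
    using X by (intro eq_vecI) auto
  then show "y = 0\<^sub>v d"
    using lin_depI[OF X y _ _ dist] full_rank_lin_indpt[OF X rank dist] by blast
qed

end

section \<open>Randomized computations\<close>

lemma nn_integral_bind_spmf:
  "nn_integral (measure_spmf (bind_spmf p f)) g =
     (\<integral>\<^sup>+x. nn_integral (measure_spmf (f x)) g \<partial>measure_spmf p)"
  unfolding measure_spmf_bind
  by (subst nn_integral_bind[where B = "count_space UNIV"])
    (auto simp: o_def space_subprob_algebra subprob_space_measure_spmf)

text \<open>The density of the supremum is the pointwise supremum of the densities. Monotone
  convergence along a chain that need not be a sequence works over a countable set, here the support
  of the supremum, which contains the supports of all members.\<close>

lemma nn_integral_lub_spmf:
  assumes chain: "Complete_Partial_Order.chain (ord_spmf (=)) Y" and Y: "Y \<noteq> {}"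
  shows "nn_integral (measure_spmf (lub_spmf Y)) f = (SUP p\<in>Y. nn_integral (measure_spmf p) f)"
proof -
  let ?M = "count_space (set_spmf (lub_spmf Y))"
  have "nn_integral (measure_spmf (lub_spmf Y)) f = (\<integral>\<^sup>+x. (SUP p\<in>Y. ennreal (spmf p x) * f x) \<partial>?M)"
    by (simp add: nn_integral_measure_spmf' ennreal_spmf_lub_spmf[OF chain Y] SUP_mult_right_ennreal Y)
  also have "\<dots> = (SUP p\<in>Y. \<integral>\<^sup>+x. ennreal (spmf p x) * f x \<partial>?M)"
  proof (rule nn_integral_monotone_convergence_SUP_countable)
    have "(\<lambda>p x. ennreal (spmf p x) * f x) ` Y = (\<lambda>g x. g x * f x) ` (\<lambda>p x. ennreal (spmf p x)) ` Y"
      by (simp add: image_image)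
    also have "Complete_Partial_Order.chain (\<le>) \<dots>"
      using chain_ord_spmf_eqD[OF chain]
      by (rule chain_imageI) (auto simp: le_fun_def intro: mult_right_mono)
    finally show "Complete_Partial_Order.chain (\<le>) ((\<lambda>p x. ennreal (spmf p x) * f x) ` Y)" .
  qed (use Y in simp_all)
  also have "\<dots> = (SUP p\<in>Y. nn_integral (measure_spmf p) f)"
    by (auto simp: nn_integral_measure_spmf nn_integral_count_space_indicator set_lub_spmf[OF chain]
        spmf_eq_0_set_spmf split: split_indicator intro!: arg_cong[of _ _ Sup] image_cong nn_integral_cong)
  finally show ?thesis .
qed

text \<open>Makes fixed-point induction applicable to moment bounds of a loop that may
  diverge.\<close>

lemma admissible_nn_integral_spmf_le:
  "ccpo.admissible lub_spmf (ord_spmf (=)) (\<lambda>p. nn_integral (measure_spmf p) f \<le> c)"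
  by (rule ccpo.admissibleI) (simp add: nn_integral_lub_spmf SUP_le_iff)

text \<open>Forgetting time is compatible with sequencing, so laws of outputs are computed as if
  programs had no cost.\<close>

lemma output_distribution_bind_rtimed [simp]:
  "output_distribution (bind_rtimed p f) = bind_spmf (output_distribution p) (\<lambda>x. output_distribution (f x))"
  by (simp add: output_distribution_def bind_rtimed_def map_spmf_bind_spmf bind_map_spmf o_def
      case_prod_beta spmf.map_comp)

lemma output_distribution_simps [simp]:
  "output_distribution (lift m) = return_spmf (fst m)"
  "output_distribution (uniform_t S) = spmf_of_set S"
  "output_distribution (bernoulli_t p) = spmf_of_pmf (bernoulli_pmf p)"
  "output_distribution (weighted_t S w) = weighted_spmf S w"
  by (simp_all add: output_distribution_def lift_def uniform_t_def bernoulli_t_def weighted_t_def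
      spmf.map_comp o_def) (simp add: pmf.map_comp o_def)

lemma set_spmf_output_distribution: "set_spmf (output_distribution p) = fst ` set_spmf p"
  by (simp add: output_distribution_def)

section \<open>Draws from weights\<close>

lemma spmf_weighted_spmf:
  assumes S: "finite S" and w: "\<And>i. i \<in> S \<Longrightarrow> 0 \<le> w i"
  shows "spmf (weighted_spmf S w) i = (if i \<in> S then w i / (\<Sum>j\<in>S. w j) else 0)"
proof -
  let ?f = "\<lambda>i. if i \<in> S then w i / (\<Sum>j\<in>S. w j) else 0"
  have nonneg: "0 \<le> ?f i" for i
    using w by (auto intro!: divide_nonneg_nonneg sum_nonneg)
  have "(\<integral>\<^sup>+i. ennreal (?f i) \<partial>count_space UNIV) = (\<integral>\<^sup>+i. ennreal (?f i) \<partial>count_space S)"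
    by (auto simp: nn_integral_count_space_indicator intro!: nn_integral_cong split: split_indicator)
  also have "\<dots> = ennreal (\<Sum>i\<in>S. ?f i)"
    using S w by (subst nn_integral_count_space_finite)
      (auto intro!: sum_ennreal divide_nonneg_nonneg sum_nonneg)
  also have "(\<Sum>i\<in>S. ?f i) = (\<Sum>i\<in>S. w i) / (\<Sum>j\<in>S. w j)"
    unfolding sum_divide_distrib by (intro sum.cong) auto
  \<comment> \<open>If all weights vanish, division by zero gives total mass 0 instead of 1; the
    inequality covers both cases.\<close>
  also have "ennreal \<dots> \<le> 1"
    by simp
  finally show ?thesis
    using nonneg[of i] by (simp add: weighted_spmf_def spmf_embed_spmf max_def)
qed

lemma weighted_spmf_cong:
  assumes "\<And>i. i \<in> S \<Longrightarrow> w i = w' i"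
  shows "weighted_spmf S w = weighted_spmf S w'"
proof -
  have "(\<Sum>j\<in>S. w j) = (\<Sum>j\<in>S. w' j)"
    using assms by simp
  then show ?thesis
    using assms unfolding weighted_spmf_def by (intro arg_cong[of _ _ embed_spmf]) auto
qed

lemma set_weighted_spmf:
  assumes "finite S" "\<And>i. i \<in> S \<Longrightarrow> 0 \<le> w i"
  shows "set_spmf (weighted_spmf S w) \<subseteq> {i \<in> S. w i \<noteq> 0}"
  by (auto simp: in_set_spmf_iff_spmf spmf_weighted_spmf assms split: if_splits)

lemma lossless_weighted_spmf:
  assumes S: "finite S" and w: "\<And>i. i \<in> S \<Longrightarrow> 0 \<le> w i" and pos: "(\<Sum>j\<in>S. w j) \<noteq> 0"
  shows "lossless_spmf (weighted_spmf S w)"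
proof -
  have "(\<integral>\<^sup>+i. ennreal (spmf (weighted_spmf S w) i) \<partial>count_space UNIV) =
      (\<integral>\<^sup>+i. ennreal (spmf (weighted_spmf S w) i) \<partial>count_space S)"
    by (auto simp: nn_integral_count_space_indicator spmf_weighted_spmf assms intro!: nn_integral_cong
        split: split_indicator)
  also have "\<dots> = ennreal (\<Sum>i\<in>S. spmf (weighted_spmf S w) i)"
    using S by (subst nn_integral_count_space_finite) (auto intro!: sum_ennreal)
  also have "(\<Sum>i\<in>S. spmf (weighted_spmf S w) i) = 1"
    using pos by (simp add: spmf_weighted_spmf assms sum_divide_distrib[symmetric])
  finally show ?thesis
    by (simp add: lossless_spmf_def weight_spmf_eq_nn_integral_spmf[symmetric])
qed

text \<open>The output of the rejection loop satisfies a fixed-point equation whose only solution is the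
  normalized acceptance probabilities, because a single trial succeeds with positive probability.\<close>

lemma output_rejection_loop:
  assumes S: "finite S" and h: "\<And>i. i \<in> S \<Longrightarrow> 0 \<le> h i \<and> h i \<le> 1" and pos: "(\<Sum>i\<in>S. h i) \<noteq> 0"
    and h_eq: "\<And>i. i \<in> S \<Longrightarrow> fst (one_minus_quad_t Z (Matrix.row X i)) = h i"
  shows "output_distribution (rejection_loop X S Z) = map_spmf (\<lambda>i. (i, h i)) (weighted_spmf S h)"
proof (rule spmf_eqI)
  fix y :: "nat \<times> real"
  define p where "p = output_distribution (rejection_loop X S Z)"
  have S_nonempty: "S \<noteq> {}"
    using pos by auto
  have p_eq: "p = bind_spmf (spmf_of_set S) (\<lambda>i. bind_spmf (spmf_of_pmf (bernoulli_pmf (fst (one_minus_quad_t Z (Matrix.row X i)))))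
      (\<lambda>A. if A then return_spmf (i, fst (one_minus_quad_t Z (Matrix.row X i))) else p))"
    unfolding p_def by (subst rejection_loop.simps) (simp add: if_distrib cong: if_cong)
  \<comment> \<open>\<open>c\<close> is the probability that a trial accepts with result
    \<open>y\<close>, times \<open>card S\<close>. It vanishes unless \<open>y\<close> pairs a row
    with its own weight.\<close>
  define c where "c = (if fst y \<in> S \<and> snd y = h (fst y) then h (fst y) else 0)"
  have "spmf p y = (\<Sum>i\<in>S. spmf (bind_spmf (spmf_of_pmf (bernoulli_pmf (fst (one_minus_quad_t Z (Matrix.row X i)))))
      (\<lambda>A. if A then return_spmf (i, fst (one_minus_quad_t Z (Matrix.row X i))) else p)) y) / card S"
    by (subst p_eq, subst spmf_bind, subst integral_spmf_of_set) simp
  also have "\<dots> = (\<Sum>i\<in>S. h i * indicator {(i, h i)} y + (1 - h i) * spmf p y) / card S"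
    by (intro arg_cong2[where f = "(/)"] sum.cong refl)
      (simp add: h_eq h spmf_bind integral_bernoulli_pmf indicator_def del: fst_one_minus_quad_t bind_spmf_of_pmf)
  also have "(\<Sum>i\<in>S. h i * indicator {(i, h i)} y + (1 - h i) * spmf p y) =
      (\<Sum>i\<in>S. h i * indicator {(i, h i)} y) + (card S - (\<Sum>i\<in>S. h i)) * spmf p y"
    by (simp add: sum.distrib sum_distrib_right[symmetric] sum_subtractf)
  also have "(\<Sum>i\<in>S. h i * indicator {(i, h i)} y) = (\<Sum>i\<in>S. if i = fst y then c else 0)"
    by (intro sum.cong refl) (auto simp: c_def indicator_def prod_eq_iff)
  also have "\<dots> = c"
    using S by (simp add: c_def)
  \<comment> \<open>The equation is linear in \<open>spmf p y\<close>: rejection carries the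
    coefficient \<open>card S\<close> minus the sum of the weights, and cancelling
    \<open>card S\<close> leaves that sum alone.\<close>
  finally have "spmf p y * (\<Sum>i\<in>S. h i) = c"
    using S S_nonempty by (simp add: field_simps)
  then have "spmf p y = c / (\<Sum>i\<in>S. h i)"
    using pos by (simp add: field_simps)
  also have "\<dots> = spmf (map_spmf (\<lambda>i. (i, h i)) (weighted_spmf S h)) y"
  proof (cases "snd y = h (fst y)")
    case True
    then have y: "y = (\<lambda>i. (i, h i)) (fst y)"
      by (simp add: prod_eq_iff)
    have "spmf (map_spmf (\<lambda>i. (i, h i)) (weighted_spmf S h)) y = spmf (weighted_spmf S h) (fst y)"
      by (subst y, rule spmf_map_inj') (simp add: inj_on_def)
    then show ?thesis
      using True by (simp add: c_def spmf_weighted_spmf S h)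
  next
    case False
    then have "y \<notin> set_spmf (map_spmf (\<lambda>i. (i, h i)) (weighted_spmf S h))"
      by auto
    then have "spmf (map_spmf (\<lambda>i. (i, h i)) (weighted_spmf S h)) y = 0"
      by (simp add: spmf_eq_0_set_spmf del: set_map_spmf)
    then show ?thesis
      using False by (simp add: c_def)
  qed
  finally show "spmf (output_distribution (rejection_loop X S Z)) y =
      spmf (map_spmf (\<lambda>i. (i, h i)) (weighted_spmf S h)) y"
    by (simp add: p_def)
qed

section \<open>Time bounds and exponential moments\<close>

definition time_le :: "'a rtimed \<Rightarrow> nat \<Rightarrow> bool" where
  "time_le p b \<longleftrightarrow> (\<forall>(x, t)\<in>set_spmf p. t \<le> b)"

lemma time_le_mono: "time_le p b \<Longrightarrow> b \<le> c \<Longrightarrow> time_le p c"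
  by (fastforce simp: time_le_def)

lemma time_le_lift: "time_le (lift m) (snd m)"
  by (simp add: time_le_def lift_def split_beta)

lemma time_le_weighted_t: "time_le (weighted_t S w) (card S)"
  by (auto simp: time_le_def weighted_t_def)

text \<open>The continuation has to be bounded only on results that can occur. Through this premise
  loop invariants enter the analysis of time.\<close>

lemma time_le_bind_rtimed:
  assumes "time_le p b" "\<And>x. x \<in> set_spmf (output_distribution p) \<Longrightarrow> time_le (f x) c"
  shows "time_le (bind_rtimed p f) (b + c)"
  using assms by (fastforce simp: time_le_def bind_rtimed_def set_bind_spmf set_spmf_output_distribution add_mono)

lemma time_le_lift_bind:
  "time_le (f (fst m)) c \<Longrightarrow> time_le (bind_rtimed (lift m) f) (snd m + c)"
  by (rule time_le_bind_rtimed[OF time_le_lift]) simp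

text \<open>The moment is taken over terminating runs, so divergence contributes zero. It is
  extended-valued because the time of the trial loop is unbounded and finiteness has to be
  shown.\<close>

definition exp_moment :: "real \<Rightarrow> 'a rtimed \<Rightarrow> ennreal" where
  "exp_moment \<theta> p = (\<integral>\<^sup>+y. ennreal (exp (\<theta> * real (snd y))) \<partial>measure_spmf p)"

lemma exp_moment_bind_rtimed:
  "exp_moment \<theta> (bind_rtimed p f) =
     (\<integral>\<^sup>+y. ennreal (exp (\<theta> * real (snd y))) * exp_moment \<theta> (f (fst y)) \<partial>measure_spmf p)"
  unfolding exp_moment_def bind_rtimed_def
  by (simp add: nn_integral_bind_spmf o_def case_prod_beta distrib_left exp_add ennreal_mult' nn_integral_cmult)

lemma exp_moment_lift: "exp_moment \<theta> (lift m) = ennreal (exp (\<theta> * real (snd m)))"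
  by (simp add: exp_moment_def lift_def measure_spmf_return_spmf nn_integral_return)

lemma exp_moment_lift_bind:
  "exp_moment \<theta> (bind_rtimed (lift m) f) = ennreal (exp (\<theta> * real (snd m))) * exp_moment \<theta> (f (fst m))"
  by (simp add: exp_moment_bind_rtimed lift_def measure_spmf_return_spmf nn_integral_return)

lemma exp_moment_uniform_t_bind:
  "exp_moment \<theta> (bind_rtimed (uniform_t S) f) = (\<Sum>i\<in>S. ennreal (exp \<theta>) * exp_moment \<theta> (f i)) / card S"
  by (simp add: exp_moment_bind_rtimed uniform_t_def o_def nn_integral_spmf_of_set)

lemma exp_moment_bernoulli_t_bind:
  assumes "0 \<le> p" "p \<le> 1"
  shows "exp_moment \<theta> (bind_rtimed (bernoulli_t p) f) =
    ennreal (exp \<theta>) * (exp_moment \<theta> (f True) * p + exp_moment \<theta> (f False) * (1 - p))"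
  using assms
  by (simp add: exp_moment_bind_rtimed bernoulli_t_def o_def nn_integral_bernoulli_pmf distrib_left mult.assoc)

text \<open>Since time is additive, moments multiply. A bound on the continuation that is uniform
  over reachable results takes the place of independence between rounds.\<close>

lemma exp_moment_bind_rtimed_le:
  assumes p: "exp_moment \<theta> p \<le> a"
    and f: "\<And>x. x \<in> set_spmf (output_distribution p) \<Longrightarrow> exp_moment \<theta> (f x) \<le> b"
  shows "exp_moment \<theta> (bind_rtimed p f) \<le> a * b"
proof -
  have "exp_moment \<theta> (bind_rtimed p f) \<le> (\<integral>\<^sup>+y. ennreal (exp (\<theta> * real (snd y))) * b \<partial>measure_spmf p)"
    unfolding exp_moment_bind_rtimed
    by (intro nn_integral_mono_AE, unfold AE_measure_spmf_iff, intro ballI mult_left_mono f)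
      (simp_all add: set_spmf_output_distribution imageI)
  also have "\<dots> = exp_moment \<theta> p * b"
    unfolding exp_moment_def by (simp add: nn_integral_multc)
  also have "\<dots> \<le> a * b"
    by (intro mult_right_mono p) simp
  finally show ?thesis .
qed

lemma exp_moment_time_le:
  assumes "time_le p b" "0 \<le> \<theta>"
  shows "exp_moment \<theta> p \<le> ennreal (exp (\<theta> * real b))"
proof -
  have "exp_moment \<theta> p \<le> (\<integral>\<^sup>+y. ennreal (exp (\<theta> * real b)) \<partial>measure_spmf p)"
    unfolding exp_moment_def using assms
    by (intro nn_integral_mono_AE)
      (auto simp: AE_measure_spmf_iff time_le_def intro!: ennreal_leI mult_left_mono)
  also have "\<dots> = ennreal (exp (\<theta> * real b)) * emeasure (measure_spmf p) UNIV"
    by (simp add: space_measure_spmf)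
  also have "\<dots> \<le> ennreal (exp (\<theta> * real b)) * 1"
    by (intro mult_left_mono measure_spmf.subprob_emeasure_le_1) simp
  finally show ?thesis
    by simp
qed

text \<open>\<open>time_le\<close> speaks of terminating runs only; losslessness ensures that they
  make up the whole mass.\<close>

lemma prob_time_le_time_le:
  assumes "time_le p b" "real b \<le> B" "lossless_spmf p"
  shows "prob_time_le p B = 1"
proof -
  have "prob_time_le p B = measure (measure_spmf p) UNIV"
    unfolding prob_time_le_def using assms(1,2)
    by (intro measure_spmf.finite_measure_eq_AE) (auto simp: AE_measure_spmf_iff time_le_def)
  then show ?thesis
    using assms(3) by (simp add: lossless_spmf_def weight_spmf_def)
qed

text \<open>A trial costs \<open>c + 2\<close>: two draws and the evaluation of the weight. If a
  fresh run has moment at most 2, a trial on row i gives at most 4/3 * (h_i + 2 * (1 - h_i)), and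
  since the h_i average at least 1/2 the mean of this is at most 2 again.\<close>

lemma exp_moment_rejection_loop:
  assumes S: "finite S" "S \<noteq> {}" and h: "\<And>i. i \<in> S \<Longrightarrow> 0 \<le> h i \<and> h i \<le> 1"
    and sum_h: "real (card S) / 2 \<le> (\<Sum>i\<in>S. h i)"
    and h_eq: "\<And>i. i \<in> S \<Longrightarrow> one_minus_quad_t Z (Matrix.row X i) = (h i, c)"
    and \<theta>: "exp (\<theta> * real (c + 2)) = 4 / 3"
  shows "exp_moment \<theta> (rejection_loop X S Z) \<le> 2"
proof (rule rejection_loop.fixp_induct[where P = "\<lambda>f. exp_moment \<theta> (f X S Z) \<le> 2"])
  \<comment> \<open>The recursion keeps its arguments, so the bound at the single argument
    \<open>((X, S), Z)\<close> is inductive by itself.\<close>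
  have "spmf.admissible (\<lambda>f. \<forall>y. y = ((X, S), Z) \<longrightarrow> exp_moment \<theta> (f y) \<le> 2)"
  proof (rule admissible_fun[OF partial_function_definitions_spmf])
    fix y :: "(real mat \<times> nat set) \<times> real mat"
    show "ccpo.admissible lub_spmf (ord_spmf (=)) (\<lambda>p. y = ((X, S), Z) \<longrightarrow> exp_moment \<theta> p \<le> 2)"
      unfolding exp_moment_def
      by (cases "y = ((X, S), Z)") (simp_all add: admissible_nn_integral_spmf_le)
  qed
  then show "spmf.admissible (\<lambda>f. exp_moment \<theta> (curry (curry f) X S Z) \<le> 2)"
    by (simp add: curry_def)
next
  show "exp_moment \<theta> (return_pmf None) \<le> 2"
    by (simp add: exp_moment_def)
next
  fix f :: "real mat \<Rightarrow> nat set \<Rightarrow> real mat \<Rightarrow> (nat \<times> real) rtimed"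
  assume IH: "exp_moment \<theta> (f X S Z) \<le> 2"
  let ?trial = "\<lambda>i. bind_rtimed (lift (one_minus_quad_t Z (Matrix.row X i)))
      (\<lambda>h. bind_rtimed (bernoulli_t h) (\<lambda>A. if A then lift (ret (i, h)) else f X S Z))"
  have trial: "ennreal (exp \<theta>) * exp_moment \<theta> (?trial i) \<le> ennreal (4 / 3 * (2 - h i))" if i: "i \<in> S" for i
  proof -
    have "exp_moment \<theta> (?trial i) = ennreal (exp (\<theta> * real c)) *
        (ennreal (exp \<theta>) * (1 * ennreal (h i) + exp_moment \<theta> (f X S Z) * ennreal (1 - h i)))"
      using h[OF i] by (simp add: exp_moment_lift_bind h_eq[OF i] exp_moment_bernoulli_t_bind exp_moment_lift)
    also have "\<dots> \<le> ennreal (exp (\<theta> * real c)) *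
        (ennreal (exp \<theta>) * (1 * ennreal (h i) + 2 * ennreal (1 - h i)))"
      by (intro mult_left_mono add_left_mono mult_right_mono IH) simp_all
    also have "1 * ennreal (h i) + 2 * ennreal (1 - h i) = ennreal (2 - h i)"
      using h[OF i] by (simp add: ennreal_mult'[symmetric] ennreal_plus[symmetric] flip: ennreal_numeral del: ennreal_plus)
    finally have "ennreal (exp \<theta>) * exp_moment \<theta> (?trial i) \<le>
        ennreal (exp \<theta>) * (ennreal (exp (\<theta> * real c)) * (ennreal (exp \<theta>) * ennreal (2 - h i)))"
      by (rule mult_left_mono) simp
    also have "\<dots> = ennreal (exp \<theta> * (exp (\<theta> * real c) * (exp \<theta> * (2 - h i))))"
      using h[OF i] by (simp add: ennreal_mult)
    also have "exp \<theta> * (exp (\<theta> * real c) * (exp \<theta> * (2 - h i))) = exp (\<theta> + \<theta> * real c + \<theta>) * (2 - h i)"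
      by (simp only: exp_add mult_ac)
    also have "\<theta> + \<theta> * real c + \<theta> = \<theta> * real (c + 2)"
      by (simp add: algebra_simps)
    finally show ?thesis
      by (simp only: \<theta>)
  qed
  have k: "0 < card S"
    using S by (simp add: card_gt_0_iff)
  have "exp_moment \<theta> (bind_rtimed (uniform_t S) ?trial) = (\<Sum>i\<in>S. ennreal (exp \<theta>) * exp_moment \<theta> (?trial i)) / card S"
    by (rule exp_moment_uniform_t_bind)
  also have "\<dots> \<le> (\<Sum>i\<in>S. ennreal (4 / 3 * (2 - h i))) / card S"
    by (intro divide_right_mono_ennreal sum_mono trial)
  also have "(\<Sum>i\<in>S. ennreal (4 / 3 * (2 - h i))) = ennreal (4 / 3 * (2 * card S - (\<Sum>i\<in>S. h i)))"
  proof -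
    have "0 \<le> 4 / 3 * (2 - h i)" if "i \<in> S" for i
      using h[OF that] by simp
    then have "(\<Sum>i\<in>S. ennreal (4 / 3 * (2 - h i))) = ennreal (\<Sum>i\<in>S. 4 / 3 * (2 - h i))"
      by (rule sum_ennreal)
    then show ?thesis
      unfolding sum_distrib_left[symmetric] sum_subtractf by (simp add: mult.commute)
  qed
  also have "\<dots> / card S \<le> ennreal (2 * card S) / card S"
    using sum_h by (intro divide_right_mono_ennreal ennreal_leI) simp
  also have "\<dots> = ennreal (2 * card S / card S)"
    using k by (simp add: divide_ennreal ennreal_of_nat_eq_real_of_nat)
  also have "\<dots> = 2"
    using k by simp
  finally show "exp_moment \<theta> (bind_rtimed (uniform_t S) ?trial) \<le> 2" .
qed

text \<open>Markov's inequality limits the mass of terminating runs that take longer than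
  \<open>b\<close>. Losslessness makes everything else a run within the bound.\<close>

lemma prob_time_le_exp_moment:
  assumes M: "exp_moment \<theta> p \<le> ennreal (\<delta> * exp (\<theta> * b))" and \<theta>: "0 < \<theta>" and "0 \<le> \<delta>"
    and lossless: "lossless_spmf p"
  shows "1 - \<delta> \<le> prob_time_le p b"
proof -
  let ?A = "{(x, t). b < real t}" and ?M = "measure_spmf p"
  have "ennreal (exp (\<theta> * b)) * emeasure ?M ?A = (\<integral>\<^sup>+y. ennreal (exp (\<theta> * b)) * indicator ?A y \<partial>?M)"
    by (simp add: nn_integral_cmult_indicator)
  also have "\<dots> \<le> exp_moment \<theta> p"
    unfolding exp_moment_def using \<theta>
    by (intro nn_integral_mono) (auto simp: indicator_def intro!: ennreal_leI)
  also have "\<dots> \<le> ennreal (exp (\<theta> * b)) * ennreal \<delta>"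
    using M \<open>0 \<le> \<delta>\<close> by (simp add: ennreal_mult[symmetric] mult.commute)
  finally have "exp (\<theta> * b) * measure ?M ?A \<le> exp (\<theta> * b) * \<delta>"
    using \<open>0 \<le> \<delta>\<close> by (simp add: measure_spmf.emeasure_eq_measure ennreal_mult[symmetric])
  then have "measure ?M ?A \<le> \<delta>"
    by simp
  moreover have "measure ?M (space ?M - ?A) = measure ?M (space ?M) - measure ?M ?A"
    by (rule measure_spmf.finite_measure_compl) simp
  moreover have "space ?M - ?A = {(x, t). real t \<le> b}"
    by (auto simp: space_measure_spmf)
  moreover have "measure ?M (space ?M) = 1"
    using lossless by (simp add: lossless_spmf_def weight_spmf_def)
  ultimately show ?thesis
    by (simp add: prob_time_le_def)
qed

section \<open>Rounds of the algorithms under the inverse invariant\<close>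

context regularized_rows
begin

lemma one_minus_quad_t_eq:
  assumes "Z \<in> carrier_mat d d"
  shows "one_minus_quad_t Z (x i) = (removal_weight Z i, d * (2 * d) + 2 * d + 1)"
  using assms by (intro prod_eqI) (auto simp: removal_weight_def)

lemma rank_one_update_t_eq:
  assumes inv: "inv_gram S Z"
  shows "rank_one_update_t Z (x i) (removal_weight Z i) = (update Z i, 6 * (d * d) + d + 1)"
proof (rule prod_eqI)
  note Z = inv_gramD(3)[OF inv]
  show "fst (rank_one_update_t Z (x i) (removal_weight Z i)) = fst (update Z i, 6 * (d * d) + d + 1)"
    using Z by (auto simp: fst_rank_one_update_t inv_gramD(7)[OF inv] update_def intro!: eq_matI)
  show "snd (rank_one_update_t Z (x i) (removal_weight Z i)) = snd (update Z i, 6 * (d * d) + d + 1)"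
    using Z by (simp add: snd_rank_one_update_t)
qed

lemma reg_gram_inverse_t_inv_gram:
  assumes "S \<subseteq> {..<n}" "Determinant.det (gram S) \<noteq> 0"
  shows "inv_gram S (fst (reg_gram_inverse_t (row_submatrix X S) lam))"
  using assms inverse_t_correct[OF gram_dim] inverse_t_carrier[OF gram_dim]
  by (simp add: inv_gram_def fst_reg_gram_inverse_t)

text \<open>For positive \<open>lam\<close> every single weight is nonzero, being a ratio of nonzero
  determinants. For \<open>lam = 0\<close> single weights may vanish, and positivity comes from the
  trace bound while more than \<open>d\<close> rows remain.\<close>

lemma sum_removal_weight_pos:
  assumes inv: "inv_gram S Z" and S: "S \<noteq> {}" and reg: "0 < lam \<or> d < card S"
  shows "0 < (\<Sum>i\<in>S. removal_weight Z i)"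
  using reg
proof
  assume "0 < lam"
  obtain i where i: "i \<in> S"
    using S by auto
  have "Determinant.det (gram (S - {i})) \<noteq> 0"
    using inv_gramD(1)[OF inv] by (intro det_gram_nonzero_regularized[OF _ \<open>0 < lam\<close>]) auto
  then have "removal_weight Z i \<noteq> 0"
    using det_gram_remove[OF inv i] by auto
  then show ?thesis
    using removal_weight_bounds[OF inv] i inv_gramD(2)[OF inv]
    by (intro sum_pos2[OF _ i]) (auto simp: less_le)
next
  assume "d < card S"
  then show ?thesis
    using sum_removal_weight_ge[OF inv] by simp
qed

text \<open>A row of weight zero lies outside the support. Every row that is drawn thus admits a
  valid update, which carries the invariant into the next round.\<close>

lemma set_weighted_removal_weight:
  assumes inv: "inv_gram S Z" and i: "i \<in> set_spmf (weighted_spmf S (removal_weight Z))"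
  shows "i \<in> S" "removal_weight Z i \<noteq> 0" "inv_gram (S - {i}) (update Z i)" "card (S - {i}) = card S - 1"
    "card (S - {i}) < card S"
proof -
  show i': "i \<in> S" "removal_weight Z i \<noteq> 0"
    using set_weighted_spmf[of S "removal_weight Z"] inv_gramD(2)[OF inv] removal_weight_bounds[OF inv] i
    by auto
  show "inv_gram (S - {i}) (update Z i)"
    by (rule inv_gram_update[OF inv i'])
  show "card (S - {i}) = card S - 1"
    using i' by simp
  show "card (S - {i}) < card S"
    by (rule card_Diff1_less[OF inv_gramD(2)[OF inv] i'(1)])
qed

lemma volume_sampling_from_step:
  assumes inv: "inv_gram S Z" and s: "s < card S"
  shows "volume_sampling_from X s lam S =
    bind_spmf (weighted_spmf S (removal_weight Z)) (\<lambda>i. volume_sampling_from X s lam (S - {i}))"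
proof -
  have "weighted_spmf S (\<lambda>i. Determinant.det (gram (S - {i})) / Determinant.det (gram S)) =
      weighted_spmf S (removal_weight Z)"
    using inv_gramD(6)[OF inv] by (intro weighted_spmf_cong) (simp add: det_gram_remove[OF inv])
  then show ?thesis
    using s by (subst volume_sampling_from.simps) simp
qed

lemma volume_sampling_from_done: "card S \<le> s \<Longrightarrow> volume_sampling_from X s lam S = return_spmf S"
  by (subst volume_sampling_from.simps) simp

text \<open>Termination is proved here, where the number of rows bounds the recursion, and is
  transferred to FastRegVol along the equality of output laws.\<close>

lemma lossless_volume_sampling_from:
  assumes "inv_gram S Z" "0 < lam \<or> d \<le> s"
  shows "lossless_spmf (volume_sampling_from X s lam S)"
  using assms(1)
proof (induction "card S" arbitrary: S Z rule: less_induct)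
  case less
  show ?case
  proof (cases "s < card S")
    case True
    then have "S \<noteq> {}" "0 < lam \<or> d < card S"
      using assms(2) by auto
    then have "lossless_spmf (weighted_spmf S (removal_weight Z))"
      using sum_removal_weight_pos[OF less.prems] removal_weight_bounds[OF less.prems] inv_gramD(2)[OF less.prems]
      by (intro lossless_weighted_spmf) auto
    moreover have "lossless_spmf (volume_sampling_from X s lam (S - {i}))"
      if "i \<in> set_spmf (weighted_spmf S (removal_weight Z))" for i
      by (rule less.hyps[OF set_weighted_removal_weight(5,3)[OF less.prems that]])
    ultimately show ?thesis
      unfolding volume_sampling_from_step[OF less.prems True] by simp
  next
    case False
    then show ?thesis
      by (simp add: volume_sampling_from_done)
  qed
qed

section \<open>RegVol\<close>

lemma scaled_image_t_eq:
  assumes "Z \<in> carrier_mat d d"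
  shows "fst (scaled_image_t Z (x i) h) = (1 / sqrt h) \<cdot>\<^sub>v (Z *\<^sub>v x i)"
  using assms by (intro eq_vecI) (auto simp: fst_scaled_image_t)

text \<open>The square root enters the outer product only squared, so for a nonnegative weight the
  result is the Sherman--Morrison correction.\<close>

lemma add_outer_t_eq:
  assumes Z: "Z \<in> carrier_mat d d" and h: "0 \<le> removal_weight Z i"
  defines "v \<equiv> fst (scaled_image_t Z (x i) (removal_weight Z i))"
  shows "fst (add_outer_t Z v v) = update Z i"
  using Z real_sqrt_mult_self[of "removal_weight Z i"] h
  by (intro eq_matI) (auto simp: fst_add_outer_t update_def v_def scaled_image_t_eq)

lemma downdate_t_eq:
  assumes Z: "Z \<in> carrier_mat d d" and h: "0 \<le> removal_weight Z i"
  shows "fst (downdate_t (removal_weight Z j) (x j) (fst (scaled_image_t Z (x i) (removal_weight Z i)))) =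
    removal_weight (update Z i) j"
proof -
  have "x j \<bullet> ((1 / sqrt (removal_weight Z i)) \<cdot>\<^sub>v (Z *\<^sub>v x i)) = (x j \<bullet> (Z *\<^sub>v x i)) / sqrt (removal_weight Z i)"
    using Z by (subst scalar_prod_smult_distrib[of _ d]) auto
  then show ?thesis
    using h by (simp add: downdate_t_simps scaled_image_t_eq[OF Z] removal_weight_update[OF Z] power_divide)
qed

text \<open>\<open>K\<close> stays fixed while \<open>S\<close> shrinks, so each round has the same
  cost bound: \<open>K * (2 * d + 3)\<close> for the draw and the weights, and
  \<open>4 * (d * d) + d + 1\<close> for the vector and the matrix update. Weights are compared on
  \<open>S\<close> only, since tables are zero elsewhere.\<close>

lemma reg_vol_loop_correct:
  assumes "inv_gram S Z" "\<And>j. j \<in> S \<Longrightarrow> h j = removal_weight Z j" "card S \<le> K"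
  shows "output_distribution (reg_vol_loop X s S Z h) = volume_sampling_from X s lam S \<and>
    time_le (reg_vol_loop X s S Z h) (card S * (K * (2 * d + 3) + 4 * (d * d) + d + 1))"
  using assms
proof (induction "card S" arbitrary: S Z h rule: less_induct)
  case less
  note inv = less.prems(1) and h = less.prems(2)
  note Z = inv_gramD(3)[OF inv]
  let ?c = "K * (2 * d + 3) + 4 * (d * d) + d + 1"
  show ?case
  proof (cases "s < card S")
    case True
    define v where "v i = fst (scaled_image_t Z (x i) (h i))" for i
    define h' where "h' i = fst (table_t (S - {i}) (\<lambda>j. downdate_t (h j) (x j) (v i)))" for i
    define cont where "cont i = bind_rtimed (lift (scaled_image_t Z (x i) (h i)))
        (\<lambda>v. bind_rtimed (lift (table_t (S - {i}) (\<lambda>j. downdate_t (h j) (x j) v)))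
          (\<lambda>h'. bind_rtimed (lift (add_outer_t Z v v)) (\<lambda>Z'. reg_vol_loop X s (S - {i}) Z' h')))" for i
    have unfold: "reg_vol_loop X s S Z h = bind_rtimed (weighted_t S h) cont"
      unfolding cont_def by (subst reg_vol_loop.simps) (simp only: True if_True)
    have weights: "weighted_spmf S h = weighted_spmf S (removal_weight Z)"
      by (rule weighted_spmf_cong) (rule h)
    have dim_v: "dim_vec (v i) = d" for i
      using Z by (simp add: v_def scaled_image_t_eq)
    have IH: "output_distribution (reg_vol_loop X s (S - {i}) (fst (add_outer_t Z (v i) (v i))) (h' i)) =
          volume_sampling_from X s lam (S - {i}) \<and>
        time_le (reg_vol_loop X s (S - {i}) (fst (add_outer_t Z (v i) (v i))) (h' i)) (card (S - {i}) * ?c)"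
      if i: "i \<in> set_spmf (weighted_spmf S (removal_weight Z))" for i
    proof -
      note i' = set_weighted_removal_weight[OF inv i]
      have hi: "0 \<le> removal_weight Z i"
        using removal_weight_bounds(1)[OF inv i'(1)] .
      have Z': "fst (add_outer_t Z (v i) (v i)) = update Z i"
        unfolding v_def h[OF i'(1)] by (rule add_outer_t_eq[OF Z hi])
      show ?thesis
        unfolding Z'
      proof (rule less.hyps[OF i'(5,3)])
        fix j assume j: "j \<in> S - {i}"
        then show "h' i j = removal_weight (update Z i) j"
          unfolding h'_def v_def using downdate_t_eq[OF Z hi, of j] h[of j] h[OF i'(1)] by simp
      qed (use i'(5) less.prems(3) in simp)
    qed
    have "output_distribution (reg_vol_loop X s S Z h) = volume_sampling_from X s lam S"
      unfolding unfold volume_sampling_from_step[OF inv True] cont_def output_distribution_bind_rtimed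
        output_distribution_simps weights return_bind_spmf v_def[symmetric] h'_def[symmetric]
      using IH by (intro bind_spmf_cong) simp_all
    moreover have "time_le (reg_vol_loop X s S Z h) (card S * ?c)"
    proof -
      have cont: "time_le (cont i) ((4 * (d * d) + d + 1) + card (S - {i}) * (2 * d + 2) + card (S - {i}) * ?c)"
        if i: "i \<in> set_spmf (output_distribution (weighted_t S h))" for i
      proof -
        have i': "i \<in> set_spmf (weighted_spmf S (removal_weight Z))"
          using i weights by simp
        have "time_le (cont i) (snd (scaled_image_t Z (x i) (h i)) +
            (snd (table_t (S - {i}) (\<lambda>j. downdate_t (h j) (x j) (v i))) +
              (snd (add_outer_t Z (v i) (v i)) + card (S - {i}) * ?c)))"
          unfolding cont_def v_def using IH[OF i', THEN conjunct2]
          by (intro time_le_lift_bind) (simp only: v_def h'_def)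
        then show ?thesis
          by (rule time_le_mono) (use Z in \<open>simp add: snd_scaled_image_t downdate_t_simps dim_v\<close>)
      qed
      have "time_le (cont i) ((4 * (d * d) + d + 1) + card S * (2 * d + 2) + (card S - 1) * ?c)"
        if i: "i \<in> set_spmf (output_distribution (weighted_t S h))" for i
      proof (rule time_le_mono[OF cont[OF i]])
        have card: "card (S - {i}) = card S - 1"
          using i weights by (intro set_weighted_removal_weight(4)[OF inv]) simp
        show "(4 * (d * d) + d + 1) + card (S - {i}) * (2 * d + 2) + card (S - {i}) * ?c \<le>
            (4 * (d * d) + d + 1) + card S * (2 * d + 2) + (card S - 1) * ?c"
          unfolding card by (intro add_mono order_refl mult_right_mono diff_le_self) simp
      qed
      then have "time_le (reg_vol_loop X s S Z h)
          (card S + ((4 * (d * d) + d + 1) + card S * (2 * d + 2) + (card S - 1) * ?c))"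
        unfolding unfold by (intro time_le_bind_rtimed time_le_weighted_t)
      moreover have "card S + ((4 * (d * d) + d + 1) + card S * (2 * d + 2) + (card S - 1) * ?c) \<le> card S * ?c"
      proof -
        have "card S * (2 * d + 3) \<le> K * (2 * d + 3)"
          using less.prems(3) by (rule mult_right_mono) simp
        then have "card S + ((4 * (d * d) + d + 1) + card S * (2 * d + 2)) \<le> ?c"
          by (simp add: algebra_simps)
        moreover have "card S * ?c = ?c + (card S - 1) * ?c"
          using True by (cases "card S") auto
        ultimately show ?thesis
          by linarith
      qed
      ultimately show ?thesis
        by (rule time_le_mono)
    qed
    ultimately show ?thesis ..
  next
    case False
    then have "reg_vol_loop X s S Z h = lift (ret S)"
      by (subst reg_vol_loop.simps) simp
    then show ?thesis
      using False time_le_mono[OF time_le_lift[of "ret S"]] by (simp add: volume_sampling_from_done)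
  qed
qed

text \<open>With at most \<open>2 * d\<close> rows every phase is cubic in \<open>d\<close>: 54 = 12
  + 10 + 32 for the initial inverse, the initial weights and the loop.\<close>

lemma reg_vol_correct:
  assumes S: "S \<subseteq> {..<n}" and det: "Determinant.det (gram S) \<noteq> 0"
  shows "output_distribution (reg_vol X S s lam) = volume_sampling_from X s lam S"
    and "card S \<le> 2 * d \<Longrightarrow> time_le (reg_vol X S s lam) (54 * (d * d * d))"
proof -
  define Z where "Z = fst (reg_gram_inverse_t (row_submatrix X S) lam)"
  define h where "h = fst (table_t S (\<lambda>i. one_minus_quad_t Z (x i)))"
  have inv: "inv_gram S Z"
    unfolding Z_def by (rule reg_gram_inverse_t_inv_gram[OF S det])
  have h: "h j = removal_weight Z j" if "j \<in> S" for j
    using that by (simp add: h_def removal_weight_def)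
  note loop = reg_vol_loop_correct[OF inv h]
  show "output_distribution (reg_vol X S s lam) = volume_sampling_from X s lam S"
    using loop[OF _ order_refl] by (simp add: reg_vol_def Z_def[symmetric] h_def[symmetric] del: table_t_simps)
  assume card: "card S \<le> 2 * d"
  let ?l = "card S * (2 * d * (2 * d + 3) + 4 * (d * d) + d + 1)"
  have loop': "time_le (reg_vol_loop X s S Z h) ?l"
    using loop[OF _ card] by simp
  have "time_le (reg_vol X S s lam) (snd (reg_gram_inverse_t (row_submatrix X S) lam) +
      (snd (table_t S (\<lambda>i. one_minus_quad_t Z (x i))) + ?l))"
    unfolding reg_vol_def Z_def using loop'
    by (intro time_le_lift_bind) (simp only: Z_def h_def)
  moreover have "snd (reg_gram_inverse_t (row_submatrix X S) lam) +
      (snd (table_t S (\<lambda>i. one_minus_quad_t Z (x i))) + ?l) \<le> 54 * (d * d * d)"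
  proof (cases "d = 0")
    case True
    then show ?thesis
      using card snd_reg_gram_inverse_t[OF row_submatrix_carrier[OF S], of lam] by simp
  next
    case False
    then have d1: "1 \<le> d * d" "d \<le> d * d"
      by auto
    have "snd (reg_gram_inverse_t (row_submatrix X S) lam) \<le> 2 * card S * (d * d) + 8 * (d * (d * d))"
      by (rule snd_reg_gram_inverse_t[OF row_submatrix_carrier[OF S]])
    also have "\<dots> \<le> 2 * (2 * d) * (d * d) + 8 * (d * (d * d))"
      using card by (intro add_mono mult_mono) auto
    finally have a: "snd (reg_gram_inverse_t (row_submatrix X S) lam) \<le> 12 * (d * d * d)"
      by simp
    have "snd (table_t S (\<lambda>i. one_minus_quad_t Z (x i))) = card S * (d * (2 * d) + 2 * d + 1)"
      by (simp add: one_minus_quad_t_eq[OF inv_gramD(3)[OF inv]])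
    moreover have "d * (2 * d) + 2 * d + 1 \<le> 5 * (d * d)"
      using d1 by linarith
    then have "card S * (d * (2 * d) + 2 * d + 1) \<le> (2 * d) * (5 * (d * d))"
      using card by (intro mult_mono) auto
    ultimately have b: "snd (table_t S (\<lambda>i. one_minus_quad_t Z (x i))) \<le> 10 * (d * d * d)"
      by (simp del: table_t_simps)
    have "2 * d * (2 * d + 3) + 4 * (d * d) + d + 1 = 8 * (d * d) + 7 * d + 1"
      by (simp add: algebra_simps)
    also have "\<dots> \<le> 16 * (d * d)"
      using d1 by linarith
    finally have "?l \<le> (2 * d) * (16 * (d * d))"
      using card by (intro mult_mono) auto
    then have "?l \<le> 32 * (d * d * d)"
      by simp
    with a b show ?thesis
      by linarith
  qed
  ultimately show "time_le (reg_vol X S s lam) (54 * (d * d * d))"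
    by (rule time_le_mono)
qed

section \<open>FastRegVol\<close>

lemma output_rejection_loop_inv_gram:
  assumes inv: "inv_gram S Z" and "d < card S"
  shows "output_distribution (rejection_loop X S Z) =
    map_spmf (\<lambda>i. (i, removal_weight Z i)) (weighted_spmf S (removal_weight Z))"
  using inv_gramD(2,3)[OF inv] removal_weight_bounds[OF inv] sum_removal_weight_pos[OF inv] assms(2)
  by (intro output_rejection_loop) (force simp: one_minus_quad_t_eq)+

lemma fast_reg_vol_loop_step:
  assumes "m < card S"
  shows "fast_reg_vol_loop X m S Z = bind_rtimed (rejection_loop X S Z)
    (\<lambda>ih. bind_rtimed (lift (rank_one_update_t Z (x (fst ih)) (snd ih)))
      (\<lambda>Z'. fast_reg_vol_loop X m (S - {fst ih}) Z'))"
  using assms by (subst fast_reg_vol_loop.simps) simp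

lemma fast_reg_vol_loop_done: "card S \<le> m \<Longrightarrow> fast_reg_vol_loop X m S Z = lift (ret S)"
  by (subst fast_reg_vol_loop.simps) simp

lemma output_fast_reg_vol_loop_step:
  assumes inv: "inv_gram S Z" and "m < card S" "2 * d \<le> m"
  shows "output_distribution (fast_reg_vol_loop X m S Z) = bind_spmf (weighted_spmf S (removal_weight Z))
    (\<lambda>i. output_distribution (fast_reg_vol_loop X m (S - {i}) (update Z i)))"
  using assms
  by (simp add: fast_reg_vol_loop_step output_rejection_loop_inv_gram bind_map_spmf o_def rank_one_update_t_eq)

text \<open>Hands to the final RegVol phase a small set whose Gram matrix is nonsingular. The
  inverse is quantified away because RegVol computes its own.\<close>

lemma set_output_fast_reg_vol_loop:
  assumes "inv_gram S Z" "2 * d \<le> m" "T \<in> set_spmf (output_distribution (fast_reg_vol_loop X m S Z))"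
  shows "card T \<le> m \<and> (\<exists>Z'. inv_gram T Z')"
  using assms(1,3)
proof (induction "card S" arbitrary: S Z rule: less_induct)
  case less
  show ?case
  proof (cases "m < card S")
    case True
    then obtain i where i: "i \<in> set_spmf (weighted_spmf S (removal_weight Z))"
      and T: "T \<in> set_spmf (output_distribution (fast_reg_vol_loop X m (S - {i}) (update Z i)))"
      using less.prems(2)
      unfolding output_fast_reg_vol_loop_step[OF less.prems(1) True assms(2)] by (auto simp: set_bind_spmf)
    show ?thesis
      using less.hyps[OF _ _ T] set_weighted_removal_weight[OF less.prems(1) i] by blast
  next
    case False
    then show ?thesis
      using less.prems by (auto simp: fast_reg_vol_loop_done)
  qed
qed

text \<open>Volume sampling is a Markov chain on sets, so its run down to size \<open>s\<close> may
  be cut when size \<open>m\<close> is reached. \<open>g\<close> stands for whatever finishes the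
  run: RegVol or an immediate return.\<close>

lemma output_fast_reg_vol_loop:
  assumes "inv_gram S Z" "2 * d \<le> m" "s \<le> m"
    and g: "\<And>T Z'. inv_gram T Z' \<Longrightarrow> card T \<le> m \<Longrightarrow> g T = volume_sampling_from X s lam T"
  shows "bind_spmf (output_distribution (fast_reg_vol_loop X m S Z)) g = volume_sampling_from X s lam S"
  using assms(1)
proof (induction "card S" arbitrary: S Z rule: less_induct)
  case less
  show ?case
  proof (cases "m < card S")
    case True
    then have "s < card S"
      using assms(3) by simp
    then show ?thesis
      unfolding output_fast_reg_vol_loop_step[OF less.prems True assms(2)]
        volume_sampling_from_step[OF less.prems \<open>s < card S\<close>] bind_spmf_assoc
      using less.hyps set_weighted_removal_weight[OF less.prems] by (intro bind_spmf_cong) auto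
  next
    case False
    then show ?thesis
      using g[OF less.prems] by (simp add: fast_reg_vol_loop_done)
  qed
qed

text \<open>A round contributes 5 = 2 * 5/2: the trial loop gives 2, and the update is charged as
  three trials, with (4/3)^3 <= 5/2.\<close>

lemma exp_moment_fast_reg_vol_loop:
  assumes "inv_gram S Z" "2 * d \<le> m" and \<theta>: "0 \<le> \<theta>" "exp (\<theta> * real (d * (2 * d) + 2 * d + 1 + 2)) = 4 / 3"
  shows "exp_moment \<theta> (fast_reg_vol_loop X m S Z) \<le> ennreal (5 ^ (card S - m))"
  using assms(1)
proof (induction "card S" arbitrary: S Z rule: less_induct)
  case less
  note inv = less.prems
  show ?case
  proof (cases "m < card S")
    case True
    let ?c = "6 * (d * d) + d + 1"
    have "exp (\<theta> * real ?c) \<le> exp (\<theta> * real (3 * (d * (2 * d) + 2 * d + 1 + 2)))"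
      using \<theta>(1) by (intro exp_le_cancel_iff[THEN iffD2] mult_left_mono of_nat_mono) auto
    also have "\<dots> = exp (\<theta> * real (d * (2 * d) + 2 * d + 1 + 2)) ^ 3"
      unfolding exp_of_nat_mult[symmetric] by (simp add: algebra_simps)
    also have "\<dots> \<le> 5 / 2"
      unfolding \<theta>(2) by (simp add: power3_eq_cube)
    finally have c: "exp (\<theta> * real ?c) \<le> 5 / 2" .
    have card: "2 * d < card S" "0 < card S"
      using True assms(2) by auto
    have "exp_moment \<theta> (rejection_loop X S Z) \<le> 2"
    proof (rule exp_moment_rejection_loop[OF inv_gramD(2)[OF inv] _ _ _ one_minus_quad_t_eq[OF inv_gramD(3)[OF inv]] \<theta>(2)])
      show "real (card S) / 2 \<le> (\<Sum>i\<in>S. removal_weight Z i)"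
        using sum_removal_weight_ge[OF inv] card by linarith
    qed (use card removal_weight_bounds[OF inv] in auto)
    moreover have "exp_moment \<theta> (bind_rtimed (lift (rank_one_update_t Z (x (fst ih)) (snd ih)))
        (\<lambda>Z'. fast_reg_vol_loop X m (S - {fst ih}) Z')) \<le> ennreal (5 / 2 * 5 ^ (card S - m - 1))"
      if ih: "ih \<in> set_spmf (output_distribution (rejection_loop X S Z))" for ih
    proof -
      obtain i where i: "i \<in> set_spmf (weighted_spmf S (removal_weight Z))" and ih: "ih = (i, removal_weight Z i)"
        using ih card by (auto simp: output_rejection_loop_inv_gram[OF inv])
      note i' = set_weighted_removal_weight[OF inv i]
      have "exp_moment \<theta> (fast_reg_vol_loop X m (S - {i}) (update Z i)) \<le> ennreal (5 ^ (card S - m - 1))"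
        using less.hyps[OF i'(5,3)] i'(4) by simp
      then have "ennreal (exp (\<theta> * real ?c)) * exp_moment \<theta> (fast_reg_vol_loop X m (S - {i}) (update Z i)) \<le>
          ennreal (5 / 2) * ennreal (5 ^ (card S - m - 1))"
        using c by (intro mult_mono ennreal_leI) auto
      then show ?thesis
        unfolding ih fst_conv snd_conv exp_moment_lift_bind rank_one_update_t_eq[OF inv]
        by (subst ennreal_mult) auto
    qed
    ultimately have "exp_moment \<theta> (fast_reg_vol_loop X m S Z) \<le> 2 * ennreal (5 / 2 * 5 ^ (card S - m - 1))"
      unfolding fast_reg_vol_loop_step[OF True] by (rule exp_moment_bind_rtimed_le)
    also have "\<dots> = ennreal 2 * ennreal (5 / 2 * 5 ^ (card S - m - 1))"
      by simp
    also have "\<dots> = ennreal (2 * (5 / 2 * 5 ^ (card S - m - 1)))"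
      by (rule ennreal_mult[symmetric]) auto
    also have "2 * (5 / 2 * 5 ^ (card S - m - 1)) = (5 :: real) ^ (card S - m)"
      using True by (cases "card S - m") auto
    finally show ?thesis .
  next
    case False
    then show ?thesis
      by (simp add: fast_reg_vol_loop_done exp_moment_lift)
  qed
qed

lemma fast_reg_vol_correct:
  assumes det: "Determinant.det (gram {..<n}) \<noteq> 0"
  shows "output_distribution (fast_reg_vol X s lam) = volume_sampling X s lam"
proof -
  define Z where "Z = fst (reg_gram_inverse_t X lam)"
  define m where "m = max s (2 * d)"
  define g where "g T = output_distribution (if s < 2 * d then reg_vol X T s lam else lift (ret T))" for T
  have inv: "inv_gram {..<n} Z"
    using reg_gram_inverse_t_inv_gram[OF order_refl det] by (simp add: Z_def row_submatrix_UNIV)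
  have "g T = volume_sampling_from X s lam T" if "inv_gram T Z'" "card T \<le> m" for T Z'
  proof (cases "s < 2 * d")
    case True
    then show ?thesis
      using reg_vol_correct(1)[OF inv_gramD(1,6)[OF that(1)]] by (simp add: g_def)
  next
    \<comment> \<open>Here \<open>m = s\<close>, so the first phase stops exactly where volume
      sampling does.\<close>
    case False
    then show ?thesis
      using that by (simp add: g_def m_def volume_sampling_from_done)
  qed
  then have "bind_spmf (output_distribution (fast_reg_vol_loop X m {..<n} Z)) g = volume_sampling_from X s lam {..<n}"
    by (intro output_fast_reg_vol_loop[OF inv]) (auto simp: m_def)
  then show ?thesis
    by (simp add: fast_reg_vol_def volume_sampling_def Z_def m_def g_def[abs_def])
qed

lemma time_le_fast_reg_vol_rest:
  assumes "inv_gram T Z'" "card T \<le> max s (2 * d)"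
  shows "time_le (if s < 2 * d then reg_vol X T s lam else lift (ret T)) (54 * (d * d * d))"
  using assms reg_vol_correct(2)[OF inv_gramD(1,6)[OF assms(1)], of s] time_le_mono[OF time_le_lift[of "ret T"]]
  by auto

text \<open>176 = 64 + 112: the first part pays for the initial inverse and the RegVol phase, the
  second for the main loop and the failure probability.\<close>

lemma prob_time_le_fast_reg_vol:
  assumes det: "Determinant.det (gram {..<n}) \<noteq> 0" and reg: "0 < lam \<or> d \<le> s"
    and d: "1 \<le> d" "d \<le> n" and \<delta>: "0 < \<delta>" "\<delta> < 1"
  shows "1 - \<delta> \<le> prob_time_le (fast_reg_vol X s lam)
    (176 * ((real n + ln (real n / real d) * ln (1 / \<delta>)) * (real d)\<^sup>2))"
proof -
  define Z where "Z = fst (reg_gram_inverse_t X lam)"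
  define m where "m = max s (2 * d)"
  define rest where "rest T = (if s < 2 * d then reg_vol X T s lam else lift (ret T))" for T
  define L where "L = ln (real n / real d) * ln (1 / \<delta>)"
  have L: "0 \<le> L"
    using d \<delta> by (simp add: L_def)
  have inv: "inv_gram {..<n} Z"
    using reg_gram_inverse_t_inv_gram[OF order_refl det] by (simp add: Z_def row_submatrix_UNIV)
  have unfold: "fast_reg_vol X s lam = bind_rtimed (lift (reg_gram_inverse_t X lam))
      (\<lambda>Z. bind_rtimed (fast_reg_vol_loop X m {..<n} Z) rest)"
    by (simp add: fast_reg_vol_def m_def rest_def[abs_def])
  have rest: "time_le (rest T) (54 * (d * d * d))" if "inv_gram T Z'" "card T \<le> m" for T Z'
    unfolding rest_def using that time_le_fast_reg_vol_rest m_def by blast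
  have lossless: "lossless_spmf (fast_reg_vol X s lam)"
    using lossless_volume_sampling_from[OF inv reg] fast_reg_vol_correct[OF det, of s]
    by (metis X_dims(1) lossless_map_spmf output_distribution_def volume_sampling_def)
  let ?i = "snd (reg_gram_inverse_t X lam)"
  \<comment> \<open>Inversion costs at most 2 n d^2 + 8 d^3 and the RegVol phase 54 d^3;
    \<open>d <= n\<close> collects them into 64 n d^2.\<close>
  have "?i + 54 * (d * d * d) \<le> 64 * (n * (d * d))"
  proof -
    have "d * (d * d) \<le> n * (d * d)"
      using d by (intro mult_right_mono) auto
    then show ?thesis
      using snd_reg_gram_inverse_t[OF X, of lam] unfolding mult.assoc by linarith
  qed
  then have "real (?i + 54 * (d * d * d)) \<le> real (64 * (n * (d * d)))"
    by (rule of_nat_mono)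
  then have overhead: "real ?i + 54 * (real d * real d * real d) \<le> 64 * (real n * (real d)\<^sup>2)"
    by (simp add: power2_eq_square)
  show ?thesis
  proof (cases "n \<le> m")
    case True
    have "time_le (fast_reg_vol X s lam) (?i + (0 + 54 * (d * d * d)))"
      unfolding unfold
    proof (intro time_le_bind_rtimed time_le_lift)
      fix Z' T assume Z': "Z' \<in> set_spmf (output_distribution (lift (reg_gram_inverse_t X lam)))"
      have loop: "fast_reg_vol_loop X m {..<n} Z' = lift (ret {..<n})"
        using True by (simp add: fast_reg_vol_loop_done)
      show "time_le (fast_reg_vol_loop X m {..<n} Z') 0"
        using time_le_lift[of "ret {..<n}"] by (simp add: loop)
      assume "T \<in> set_spmf (output_distribution (fast_reg_vol_loop X m {..<n} Z'))"
      then show "time_le (rest T) (54 * (d * d * d))"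
        using rest[OF inv] True by (simp add: loop)
    qed
    moreover have "real (?i + (0 + 54 * (d * d * d))) \<le> 176 * ((real n + L) * (real d)\<^sup>2)"
    proof -
      have "real n * (real d)\<^sup>2 \<le> (real n + L) * (real d)\<^sup>2"
        using L by (intro mult_right_mono) auto
      moreover have "0 \<le> real n * (real d)\<^sup>2"
        by simp
      moreover have "real (?i + (0 + 54 * (d * d * d))) = real ?i + 54 * (real d * real d * real d)"
        by simp
      ultimately show ?thesis
        using overhead by linarith
    qed
    ultimately have "prob_time_le (fast_reg_vol X s lam) (176 * ((real n + L) * (real d)\<^sup>2)) = 1"
      by (rule prob_time_le_time_le[OF _ _ lossless])
    then show ?thesis
      using \<delta> by (simp add: L_def)
  next
    case False
    \<comment> \<open>\<open>q\<close> is the cost of one trial and \<open>\<theta>\<close> is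
      calibrated to it. From ln (4/3) >= 1/4 and q <= 7 d^2 comes the constant 1/28 below.\<close>
    define q where "q = real (d * (2 * d) + 2 * d + 1 + 2)"
    define \<theta> where "\<theta> = ln (4 / 3) / q"
    have q: "0 < q"
      unfolding q_def of_nat_0_less_iff by simp
    \<comment> \<open>The inequality ln t <= t - 1 is applied to the reciprocal 3/4, which turns it
      into a lower bound; likewise for ln 2 below.\<close>
    have ln43: "1 / 4 \<le> ln (4 / 3 :: real)"
      using ln_le_minus_one[of "3 / 4"] by (simp add: ln_div)
    then have \<theta>: "0 < \<theta>" "exp (\<theta> * q) = 4 / 3"
      using q by (simp_all add: \<theta>_def)
    have "q \<le> 7 * (real d)\<^sup>2"
    proof -
      have "d \<le> d * d" "1 \<le> d * d"
        using d by auto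
      then have "d * (2 * d) + 2 * d + 1 + 2 \<le> 7 * (d * d)"
        by linarith
      then have "q \<le> real (7 * (d * d))"
        unfolding q_def by (rule of_nat_mono)
      then show ?thesis
        by (simp add: power2_eq_square)
    qed
    then have "\<theta> * q \<le> \<theta> * (7 * (real d)\<^sup>2)"
      using \<theta> by (intro mult_left_mono) auto
    moreover have "\<theta> * q = ln (4 / 3)"
      using q by (simp add: \<theta>_def)
    ultimately have \<theta>d: "1 / 28 \<le> \<theta> * (real d)\<^sup>2"
      using ln43 by simp
    have n2d: "2 * d < n"
      using False by (simp add: m_def)
    have "1 / 2 \<le> ln (2 :: real)"
      using ln_le_minus_one[of "1 / 2"] by (simp add: ln_div)
    also have "\<dots> \<le> ln (real n / real d)"
      using n2d d by (simp add: field_simps)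
    finally have "1 / 2 * ln (1 / \<delta>) \<le> L"
      unfolding L_def using \<delta> by (intro mult_right_mono) auto
    then have ln\<delta>: "ln (1 / \<delta>) \<le> 2 * L"
      by simp
    have "exp_moment \<theta> (fast_reg_vol X s lam) \<le> ennreal (exp (\<theta> * real ?i)) *
        (ennreal (5 ^ (n - m)) * ennreal (exp (\<theta> * real (54 * (d * d * d)))))"
      unfolding unfold exp_moment_lift_bind Z_def[symmetric]
    proof (intro mult_left_mono exp_moment_bind_rtimed_le)
      show "exp_moment \<theta> (fast_reg_vol_loop X m {..<n} Z) \<le> ennreal (5 ^ (n - m))"
        using exp_moment_fast_reg_vol_loop[OF inv, of m \<theta>] \<theta> by (simp add: m_def q_def)
      fix T assume "T \<in> set_spmf (output_distribution (fast_reg_vol_loop X m {..<n} Z))"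
      then obtain Z' where "inv_gram T Z'" "card T \<le> m"
        using set_output_fast_reg_vol_loop[OF inv, of m T] by (auto simp: m_def)
      then show "exp_moment \<theta> (rest T) \<le> ennreal (exp (\<theta> * real (54 * (d * d * d))))"
        using \<theta> by (intro exp_moment_time_le rest) auto
    qed simp
    also have "\<dots> = ennreal (exp (\<theta> * (real ?i + 54 * (real d * real d * real d))) * 5 ^ (n - m))"
      by (simp add: ennreal_mult[symmetric] exp_add distrib_left mult_ac)
    also have "\<dots> \<le> ennreal (\<delta> * exp (\<theta> * (176 * ((real n + L) * (real d)\<^sup>2))))"
    proof (rule ennreal_leI)
      have "(5 :: real) ^ (n - m) \<le> 5 ^ n"
        by (rule power_increasing) auto
      also have "\<dots> = exp (real n * ln 5)"
        by (simp add: exp_of_nat_mult)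
      also have "\<dots> \<le> exp (real n * 4)"
        using ln_le_minus_one[of 5] by (simp add: mult_left_mono)
      finally have five: "5 ^ (n - m) \<le> exp (real n * 4)" .
      have \<delta>_exp: "\<delta> = exp (- ln (1 / \<delta>))"
        using \<delta> by (simp add: ln_div)
      have "\<theta> * (real ?i + 54 * (real d * real d * real d)) \<le> \<theta> * (64 * (real n * (real d)\<^sup>2))"
        using \<theta> overhead by (intro mult_left_mono) auto
      \<comment> \<open>112 = 4 * 28: here 4 n dominates n ln 5, and ln (1 / \<delta>) <= 2 L is
        absorbed by 4 L.\<close>
      moreover have "4 * (real n + L) \<le> \<theta> * (real d)\<^sup>2 * (112 * (real n + L))"
      proof -
        have "1 / 28 * (112 * (real n + L)) \<le> \<theta> * (real d)\<^sup>2 * (112 * (real n + L))"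
          using \<theta>d L by (intro mult_right_mono) auto
        then show ?thesis
          by simp
      qed
      moreover have "0 \<le> \<theta> * (real d)\<^sup>2 * (64 * L)"
        using \<theta> L by simp
      ultimately have key: "\<theta> * (real ?i + 54 * (real d * real d * real d)) + real n * 4 \<le>
          - ln (1 / \<delta>) + \<theta> * (176 * ((real n + L) * (real d)\<^sup>2))"
        using ln\<delta> L by (simp add: algebra_simps)
      have "exp (\<theta> * (real ?i + 54 * (real d * real d * real d))) * 5 ^ (n - m) \<le>
          exp (\<theta> * (real ?i + 54 * (real d * real d * real d))) * exp (real n * 4)"
        using five by (intro mult_left_mono) auto
      also have "\<dots> \<le> exp (- ln (1 / \<delta>)) * exp (\<theta> * (176 * ((real n + L) * (real d)\<^sup>2)))"
        using key by (simp only: exp_add[symmetric] exp_le_cancel_iff)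
      finally show "exp (\<theta> * (real ?i + 54 * (real d * real d * real d))) * 5 ^ (n - m) \<le>
          \<delta> * exp (\<theta> * (176 * ((real n + L) * (real d)\<^sup>2)))"
        using \<delta>_exp by simp
    qed
    finally have "exp_moment \<theta> (fast_reg_vol X s lam) \<le> ennreal (\<delta> * exp (\<theta> * (176 * ((real n + L) * (real d)\<^sup>2))))" .
    then show ?thesis
      unfolding L_def using \<theta> \<delta> lossless by (intro prob_time_le_exp_moment) auto
  qed
qed

end

theorem theorem5p3:
  shows "\<exists>C>0. \<forall>(n::nat) (d::nat) (X::real mat) (lam::real) (s::nat) (\<delta>::real).
           1 \<le> d \<longrightarrow> d \<le> n \<longrightarrow> X \<in> carrier_mat n d \<longrightarrow> 0 \<le> lam \<longrightarrow> s \<le> n \<longrightarrow>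
           0 < \<delta> \<longrightarrow> \<delta> < 1 \<longrightarrow>
           (lam = 0 \<longrightarrow> vec_space.rank n X = d \<and> d \<le> s) \<longrightarrow>
             output_distribution (fast_reg_vol X s lam) = volume_sampling X s lam \<and>
             prob_time_le (fast_reg_vol X s lam)
               (C * ((real n + ln (real n / real d) * ln (1 / \<delta>)) * (real d)\<^sup>2)) \<ge> 1 - \<delta>"
proof (intro exI[of _ 176] conjI allI impI)
  fix n d :: nat and X :: "real mat" and lam :: real and s :: nat and \<delta> :: real
  assume d: "1 \<le> d" "d \<le> n" and X: "X \<in> carrier_mat n d" and lam: "0 \<le> lam" and \<delta>: "0 < \<delta>" "\<delta> < 1"
    and rank: "lam = 0 \<longrightarrow> vec_space.rank n X = d \<and> d \<le> s"
  interpret regularized_rows X n d lam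
    by unfold_locales (rule X, rule lam)
  have reg: "0 < lam \<or> d \<le> s"
    using rank lam by auto
  \<comment> \<open>Nonsingularity for the full set of rows starts the invariant; the two
    alternatives, positive \<open>lam\<close> and full rank, meet here.\<close>
  have det: "Determinant.det (gram {..<n}) \<noteq> 0"
    using rank lam det_gram_nonzero_full_rank det_gram_nonzero_regularized[OF order_refl] by (cases "lam = 0") auto
  show "output_distribution (fast_reg_vol X s lam) = volume_sampling X s lam"
    by (rule fast_reg_vol_correct[OF det])
  show "1 - \<delta> \<le> prob_time_le (fast_reg_vol X s lam)
      (176 * ((real n + ln (real n / real d) * ln (1 / \<delta>)) * (real d)\<^sup>2))"
    by (rule prob_time_le_fast_reg_vol[OF det reg d \<delta>])
qed simp

end
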